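(* For every partition $\lambda$, the Schur function $s_\lambda$ is extreme in the cone $$\mathcal{K}=\Big\{\sum_\alpha c_\alpha F_\alpha\in\Lambda\ \Big|\ c_\alpha\ge0\text{ for all }\alpha\Big\};$$ that is, $s_\lambda\in\mathcal{K}$ and whenever $s_\lambda=F_1+F_2$ with $F_1,F_2\in\mathcal{K}$, both $F_1$ and $F_2$ are scalar multiples of $s_\lambda$.
   Context: $\Lambda$ is the algebra of symmetric functions over $\mathbb{Q}$, a subalgebra of the algebra $\mathcal{Q}$ of quasisymmetric functions over $\mathbb{Q}$. For a composition $\beta=\beta_1\cdots\beta_k$ (finite list of positive integers), $M_\beta=\sum_{i_1<\cdots<i_k}x_{i_1}^{\beta_1}\cdots x_{i_k}^{\beta_k}$ and $F_\beta=\sum_{\gamma\le\beta}M_\gamma$, where the sum is over all refinements $\gamma$ of $\beta$ (compositions from which $\beta$ is obtained by adding together adjacent components); $F_0=1$. The $F_\beta$ (fundamental basis) form a basis of $\mathcal{Q}$. *)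

theory Defs
  imports Complex_Main "HOL-Library.Poly_Mapping" "HOL-Library.Function_Algebras"
begin

text \<open>
  Monomials in countably many variables are finitely supported exponent functions, and a formal
  power series over the rationals is the function assigning to each monomial its coefficient.
  Addition and finite sums of series are the pointwise ones. The variables are numbered from 0
  rather than from 1.
\<close>

type_synonym monomial = "nat \<Rightarrow>\<^sub>0 nat"
type_synonym series = "monomial \<Rightarrow> rat"

definition scale :: "rat \<Rightarrow> series \<Rightarrow> series" where
  "scale a f = (\<lambda>m. a * f m)"

definition total_degree :: "monomial \<Rightarrow> nat" where
  "total_degree m = (\<Sum>i\<in>Poly_Mapping.keys m. Poly_Mapping.lookup m i)"

text \<open>The condition on \<open>d\<close> is bounded degree; without it one gets the completion of the ring.\<close>

definition Sym :: "series set" where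
  "Sym = {f. (\<exists>d. \<forall>m. f m \<noteq> 0 \<longrightarrow> total_degree m \<le> d) \<and>
             (\<forall>\<pi>. bij \<pi> \<longrightarrow> (\<forall>m. f (Poly_Mapping.map_key \<pi> m) = f m))}"

definition composition :: "nat list \<Rightarrow> bool" where
  "composition \<alpha> \<longleftrightarrow> (\<forall>a\<in>set \<alpha>. 0 < a)"

definition partition :: "nat list \<Rightarrow> bool" where
  "partition \<mu> \<longleftrightarrow> composition \<mu> \<and> sorted_wrt (\<ge>) \<mu>"

definition refines :: "nat list \<Rightarrow> nat list \<Rightarrow> bool" where
  "refines \<gamma> \<beta> \<longleftrightarrow>
     composition \<gamma> \<and> (\<exists>bs. [] \<notin> set bs \<and> concat bs = \<gamma> \<and> map sum_list bs = \<beta>)"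

text \<open>
  The coefficient of a monomial in \<open>M \<beta>\<close> is the number of index sequences
  \<open>i\<^sub>1 < \<dots> < i\<^sub>k\<close> whose summand is that monomial.
\<close>

definition monomial_qsym :: "nat list \<Rightarrow> series" where
  "monomial_qsym \<beta> = (\<lambda>m. of_nat (card {is. length is = length \<beta> \<and> sorted_wrt (<) is \<and>
     sum_list (map2 Poly_Mapping.single is \<beta>) = m}))"

definition fundamental_qsym :: "nat list \<Rightarrow> series" where
  "fundamental_qsym \<beta> = (\<Sum>\<gamma> | refines \<gamma> \<beta>. monomial_qsym \<gamma>)"

text \<open>
  A semistandard Young tableau is given as the list of its rows (English notation): rows
  weakly increase, columns strictly increase.
\<close>

definition ssyt :: "nat list \<Rightarrow> nat list list \<Rightarrow> bool" where
  "ssyt \<mu> T \<longleftrightarrow> map length T = \<mu> \<and> (\<forall>r\<in>set T. sorted r) \<and>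
     (\<forall>i j. Suc i < length T \<and> j < length (T ! Suc i) \<longrightarrow> T ! i ! j < T ! Suc i ! j)"

definition tableau_monomial :: "nat list list \<Rightarrow> monomial" where
  "tableau_monomial T = sum_list (map (\<lambda>k. Poly_Mapping.single k 1) (concat T))"

definition schur :: "nat list \<Rightarrow> series" where
  "schur \<mu> = (\<lambda>m. of_nat (card {T. ssyt \<mu> T \<and> tableau_monomial T = m}))"

text \<open>Since the fundamental functions are a basis, expansions have finitely many nonzero terms.\<close>

definition F_positive_cone :: "series set" where
  "F_positive_cone = {f \<in> Sym. \<exists>c :: nat list \<Rightarrow> rat.
     (\<forall>\<alpha>. 0 \<le> c \<alpha>) \<and> (\<forall>\<alpha>. c \<alpha> \<noteq> 0 \<longrightarrow> composition \<alpha>) \<and> finite {\<alpha>. c \<alpha> \<noteq> 0} \<and>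
     f = (\<Sum>\<alpha> | c \<alpha> \<noteq> 0. scale (c \<alpha>) (fundamental_qsym \<alpha>))}"

end

theory Submission
  imports Defs "HOL-Library.Multiset"
begin

text \<open>
  Write \<open>n(\<nu>) = \<Sum>\<^sub>i i \<nu>\<^sub>i\<close> with rows, and likewise the entries of tableaux, numbered from \<open>0\<close>.
  This one statistic isolates \<open>s\<^sub>\<mu>\<close> from two opposite sides.

  Columns of a semistandard tableau increase strictly, so every entry is at least the number of
  its row. Summing over the cells, \<open>x\<^sup>\<nu>\<close> occurs in \<open>s\<^sub>\<kappa>\<close> only if \<open>n(\<kappa>) \<le> n(\<nu>)\<close>, and equality forces
  \<open>\<kappa> = \<nu>\<close> (\<open>kostka_nonzero\<close>). In particular the Schur functions span the symmetric functions by
  triangular elimination (\<open>symmetric_schur_combination\<close>). On the other side, let \<open>\<alpha>\<close> be the descent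
  composition of the standard tableau of shape \<open>\<nu>\<close> that is filled column by column. A standard
  tableau with the same descents must go down at least one row at every descent, so the cells it
  visits lie at least as low. Hence \<open>F\<^sub>\<alpha>\<close> occurs in \<open>s\<^sub>\<kappa>\<close> only if \<open>n(\<nu>) \<le> n(\<kappa>)\<close>, and equality again
  forces \<open>\<kappa> = \<nu>\<close> (\<open>ex_extremal_descents\<close>).

  Now let \<open>s\<^sub>\<mu> = f + g\<close> in the cone and \<open>f = \<Sum>\<^sub>\<nu> a\<^sub>\<nu> s\<^sub>\<nu>\<close>. All coefficients being nonnegative, each
  monomial and each \<open>F\<^sub>\<alpha>\<close> that occurs in \<open>f\<close> occurs in \<open>s\<^sub>\<mu>\<close> as well. Among the \<open>\<nu>\<close> with \<open>a\<^sub>\<nu> \<noteq> 0\<close>, one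
  that minimises \<open>n\<close> leaves \<open>x\<^sup>\<nu>\<close> uncancelled in \<open>f\<close>, so \<open>n(\<mu>) \<le> n(\<nu>)\<close> with equality only for
  \<open>\<nu> = \<mu>\<close>. One that maximises \<open>n\<close> leaves its \<open>F\<^sub>\<alpha>\<close> uncancelled, so \<open>n(\<nu>) \<le> n(\<mu>)\<close>. Thus \<open>n\<close> is constant
  on these \<open>\<nu>\<close>, every one of them is a minimiser, and \<open>f\<close> is a multiple of \<open>s\<^sub>\<mu>\<close>
  (\<open>schur_summand_proportional\<close>).

  That \<open>s\<^sub>\<mu>\<close> itself lies in the cone rests on two encodings of tableaux. Peeling off the largest
  entry again and again gives a chain of interlacing shapes, counted by \<open>kostka\<close>. Reflecting one
  shape of the chain between its neighbours is the Bender-Knuth involution and yields symmetry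
  (\<open>kostka_mset\<close>). Writing down the rows of the cells in the order in which a standardised tableau
  fills them gives a lattice word. A word contributes to the coefficient of a monomial exactly when
  the exponents refine the lengths of its monotone runs, which is the expansion into fundamental
  functions with nonnegative coefficients (\<open>schur_expansion\<close>).
\<close>

section \<open>Chains of interlacing shapes\<close>

text \<open>
  Shapes are functions from row numbers to row lengths, so that the last row needs no special
  treatment. Interlacing says that \<open>\<kappa>\<close> arises from \<open>\<rho>\<close> by adding a horizontal strip.
\<close>
definition interlaces :: "(nat \<Rightarrow> nat) \<Rightarrow> (nat \<Rightarrow> nat) \<Rightarrow> bool" where
  "interlaces \<rho> \<kappa> \<longleftrightarrow> (\<forall>i. \<rho> i \<le> \<kappa> i \<and> \<kappa> (Suc i) \<le> \<rho> i)"

definition supported :: "nat \<Rightarrow> (nat \<Rightarrow> nat) \<Rightarrow> bool" where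
  "supported L \<kappa> \<longleftrightarrow> (\<forall>i\<ge>L. \<kappa> i = 0)"

definition strip_removals :: "nat \<Rightarrow> (nat \<Rightarrow> nat) \<Rightarrow> nat \<Rightarrow> (nat \<Rightarrow> nat) set" where
  "strip_removals L \<kappa> a = {\<rho>. interlaces \<rho> \<kappa> \<and> sum \<rho> {..<L} + a = sum \<kappa> {..<L}}"

text \<open>
  The weights are listed with the last strip first. \<open>L\<close> bounds the number of rows and makes the
  sizes of the shapes finite sums.
\<close>
fun kostka :: "nat \<Rightarrow> (nat \<Rightarrow> nat) \<Rightarrow> nat list \<Rightarrow> nat" where
  "kostka L \<kappa> [] = of_bool (\<kappa> = (\<lambda>_. 0))"
| "kostka L \<kappa> (a # \<gamma>) = (\<Sum>\<rho>\<in>strip_removals L \<kappa> a. kostka L \<rho> \<gamma>)"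

lemma interlaces_supported: "interlaces \<rho> \<kappa> \<Longrightarrow> supported L \<kappa> \<Longrightarrow> supported L \<rho>"
  unfolding interlaces_def supported_def by (metis le_zero_eq)

lemma strip_removals_supported:
  "\<rho> \<in> strip_removals L \<kappa> a \<Longrightarrow> supported L \<kappa> \<Longrightarrow> supported L \<rho>"
  unfolding strip_removals_def by (blast intro: interlaces_supported)

lemma interlaces_antimono:
  assumes "interlaces \<rho> \<kappa>"
  shows "antimono \<rho>"
  using assms unfolding interlaces_def decseq_Suc_iff by (meson le_trans)

lemma finite_strip_removals [simp]:
  assumes "supported L \<kappa>"
  shows "finite (strip_removals L \<kappa> a)"
proof (rule finite_subset)
  let ?B = "{..sum \<kappa> {..<L}}"
  show "strip_removals L \<kappa> a \<subseteq> {\<rho>. \<forall>i. (i \<in> {..<L} \<longrightarrow> \<rho> i \<in> ?B) \<and> (i \<notin> {..<L} \<longrightarrow> \<rho> i = 0)}"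
  proof clarify
    fix \<rho> i assume r: "\<rho> \<in> strip_removals L \<kappa> a"
    then have le: "\<rho> i \<le> \<kappa> i"
      by (simp add: strip_removals_def interlaces_def)
    moreover have "\<kappa> i \<le> sum \<kappa> {..<L}" if "i \<in> {..<L}"
      using that by (intro member_le_sum) auto
    moreover have "\<rho> i = 0" if "i \<notin> {..<L}"
      using le that assms by (auto simp: supported_def)
    ultimately show "(i \<in> {..<L} \<longrightarrow> \<rho> i \<in> ?B) \<and> (i \<notin> {..<L} \<longrightarrow> \<rho> i = 0)"
      by auto
  qed
  show "finite {\<rho>. \<forall>i. (i \<in> {..<L} \<longrightarrow> \<rho> i \<in> ?B) \<and> (i \<notin> {..<L} \<longrightarrow> \<rho> i = 0)}"
    by (rule finite_set_of_finite_funs) auto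
qed

text \<open>
  For fixed outer shape \<open>\<kappa>\<close> and inner shape \<open>\<tau>\<close> the row lengths of the shape between them range
  independently over intervals, whose ends are given by the next two functions. Reversing all these
  intervals at once is the Bender-Knuth involution.
\<close>
definition lower_bound :: "(nat \<Rightarrow> nat) \<Rightarrow> (nat \<Rightarrow> nat) \<Rightarrow> nat \<Rightarrow> nat" where
  "lower_bound \<kappa> \<tau> i = max (\<tau> i) (\<kappa> (Suc i))"

fun upper_bound :: "(nat \<Rightarrow> nat) \<Rightarrow> (nat \<Rightarrow> nat) \<Rightarrow> nat \<Rightarrow> nat" where
  "upper_bound \<kappa> \<tau> 0 = \<kappa> 0"
| "upper_bound \<kappa> \<tau> (Suc i) = min (\<kappa> (Suc i)) (\<tau> i)"

definition reflect :: "(nat \<Rightarrow> nat) \<Rightarrow> (nat \<Rightarrow> nat) \<Rightarrow> (nat \<Rightarrow> nat) \<Rightarrow> nat \<Rightarrow> nat" where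
  "reflect \<kappa> \<tau> \<rho> i = lower_bound \<kappa> \<tau> i + upper_bound \<kappa> \<tau> i - \<rho> i"

lemma interlaces_both_iff:
  "interlaces \<rho> \<kappa> \<and> interlaces \<tau> \<rho> \<longleftrightarrow>
     (\<forall>i. lower_bound \<kappa> \<tau> i \<le> \<rho> i \<and> \<rho> i \<le> upper_bound \<kappa> \<tau> i)" (is "?L \<longleftrightarrow> ?R")
proof
  assume l: ?L
  show ?R
  proof
    fix i show "lower_bound \<kappa> \<tau> i \<le> \<rho> i \<and> \<rho> i \<le> upper_bound \<kappa> \<tau> i"
      using l by (cases i) (auto simp: interlaces_def lower_bound_def)
  qed
next
  assume r: ?R
  have "\<rho> i \<le> \<kappa> i" for i using r[rule_format, of i] by (cases i) auto
  moreover have "\<rho> (Suc i) \<le> \<tau> i" for i using r[rule_format, of "Suc i"] by auto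
  ultimately show ?L using r by (auto simp: interlaces_def lower_bound_def)
qed

text \<open>
  The lower bound of a row and the upper bound of the next one are the maximum and the minimum of the
  same two numbers, so the sum telescopes. It follows that \<open>reflect\<close> exchanges the sizes of the two
  strips.
\<close>
lemma sum_bounds:
  assumes "supported L \<kappa>" "supported L \<tau>"
  shows "(\<Sum>i<L. lower_bound \<kappa> \<tau> i + upper_bound \<kappa> \<tau> i) = sum \<kappa> {..<L} + sum \<tau> {..<L}"
proof -
  have "(\<Sum>i<n. lower_bound \<kappa> \<tau> i) + (\<Sum>i<Suc n. upper_bound \<kappa> \<tau> i)
      = (\<Sum>i<Suc n. \<kappa> i) + (\<Sum>i<n. \<tau> i)" for n
    by (induction n) (auto simp: lower_bound_def)
  from this[of L] have "(\<Sum>i<L. lower_bound \<kappa> \<tau> i) + (\<Sum>i<L. upper_bound \<kappa> \<tau> i) + upper_bound \<kappa> \<tau> L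
      = sum \<kappa> {..<L} + sum \<tau> {..<L} + \<kappa> L" by simp
  moreover have "upper_bound \<kappa> \<tau> L = \<kappa> L"
    using assms by (cases L) (auto simp: supported_def)
  ultimately show ?thesis by (simp add: sum.distrib)
qed

lemma reflect_strips:
  assumes "supported L \<kappa>" "\<rho> \<in> strip_removals L \<kappa> a" "\<tau> \<in> strip_removals L \<rho> b"
  shows "reflect \<kappa> \<tau> \<rho> \<in> strip_removals L \<kappa> b" "\<tau> \<in> strip_removals L (reflect \<kappa> \<tau> \<rho>) a"
    "reflect \<kappa> \<tau> (reflect \<kappa> \<tau> \<rho>) = \<rho>"
proof -
  have bounds: "lower_bound \<kappa> \<tau> i \<le> \<rho> i" "\<rho> i \<le> upper_bound \<kappa> \<tau> i" for i
    using assms interlaces_both_iff[of \<rho> \<kappa> \<tau>] by (auto simp: strip_removals_def)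
  have supp: "supported L \<tau>"
    using assms strip_removals_supported by blast
  have "(\<Sum>i<L. reflect \<kappa> \<tau> \<rho> i + \<rho> i) = (\<Sum>i<L. lower_bound \<kappa> \<tau> i + upper_bound \<kappa> \<tau> i)"
    using bounds by (intro sum.cong) (auto simp: reflect_def trans_le_add2)
  then have sums: "sum (reflect \<kappa> \<tau> \<rho>) {..<L} + sum \<rho> {..<L} = sum \<kappa> {..<L} + sum \<tau> {..<L}"
    using sum_bounds[OF assms(1) supp] by (simp add: sum.distrib)
  have "lower_bound \<kappa> \<tau> i \<le> reflect \<kappa> \<tau> \<rho> i \<and> reflect \<kappa> \<tau> \<rho> i \<le> upper_bound \<kappa> \<tau> i" for i
    using bounds[of i] by (auto simp: reflect_def)
  then have "interlaces (reflect \<kappa> \<tau> \<rho>) \<kappa> \<and> interlaces \<tau> (reflect \<kappa> \<tau> \<rho>)"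
    using interlaces_both_iff by blast
  then show "reflect \<kappa> \<tau> \<rho> \<in> strip_removals L \<kappa> b" "\<tau> \<in> strip_removals L (reflect \<kappa> \<tau> \<rho>) a"
    using sums assms(2,3) by (auto simp: strip_removals_def)
  show "reflect \<kappa> \<tau> (reflect \<kappa> \<tau> \<rho>) = \<rho>"
  proof
    fix i show "reflect \<kappa> \<tau> (reflect \<kappa> \<tau> \<rho>) i = \<rho> i"
      using bounds[of i] by (simp add: reflect_def)
  qed
qed

lemma kostka_swap_first:
  assumes "supported L \<kappa>"
  shows "kostka L \<kappa> (a # b # \<gamma>) = kostka L \<kappa> (b # a # \<gamma>)"
proof -
  define P where "P a b = Sigma (strip_removals L \<kappa> a) (\<lambda>\<rho>. strip_removals L \<rho> b)" for a b
  have *: "kostka L \<kappa> (a # b # \<gamma>) = (\<Sum>(\<rho>, \<tau>)\<in>P a b. kostka L \<tau> \<gamma>)" for a b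
    unfolding P_def using assms
    by (simp, subst sum.Sigma) (auto intro: strip_removals_supported finite_strip_removals)
  have "(\<Sum>(\<rho>, \<tau>)\<in>P a b. kostka L \<tau> \<gamma>) = (\<Sum>(\<rho>, \<tau>)\<in>P b a. kostka L \<tau> \<gamma>)"
    by (rule sum.reindex_bij_witness[where i = "\<lambda>(\<rho>, \<tau>). (reflect \<kappa> \<tau> \<rho>, \<tau>)"
          and j = "\<lambda>(\<rho>, \<tau>). (reflect \<kappa> \<tau> \<rho>, \<tau>)"])
      (use reflect_strips[OF assms] in \<open>auto simp: P_def\<close>)
  then show ?thesis by (simp only: *)
qed

lemma kostka_swap:
  assumes "supported L \<kappa>"
  shows "kostka L \<kappa> (\<delta> @ a # b # \<gamma>) = kostka L \<kappa> (\<delta> @ b # a # \<gamma>)"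
  using assms
proof (induction \<delta> arbitrary: \<kappa>)
  case Nil
  then show ?case using kostka_swap_first by simp
next
  case (Cons d \<delta>)
  then show ?case by (auto intro!: sum.cong strip_removals_supported)
qed

text \<open>
  Adjacent transpositions generate all rearrangements: the head of the second list is moved to the
  front of the first one step by step.
\<close>
lemma eq_if_mset_eq_of_adjacent_swaps:
  assumes "\<And>us a b vs. f (us @ a # b # vs) = f (us @ b # a # vs)" and "mset xs = mset ys"
  shows "f xs = f ys"
  using assms
proof (induction ys arbitrary: xs f)
  case Nil
  then show ?case by simp
next
  case (Cons y ys)
  have "y \<in> set xs" using Cons.prems(2) by (metis list.set_intros(1) set_mset_mset)
  then obtain us vs where xs: "xs = us @ y # vs" by (meson split_list)
  \<comment> \<open>Moving \<open>y\<close> to the front must be possible for any tail \<open>ws\<close>, as the tail grows in the induction.\<close>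
  have move: "f (us @ y # ws) = f (y # us @ ws)" for ws
  proof (induction us arbitrary: ws rule: rev_induct)
    case (snoc u us)
    then show ?case using Cons.prems(1)[of us u y ws] by simp
  qed simp
  have "f (y # (us @ vs)) = f (y # ys)"
  proof (rule Cons.IH[of "\<lambda>zs. f (y # zs)"])
    show "f (y # us' @ a # b # vs') = f (y # us' @ b # a # vs')" for us' a b vs'
      using Cons.prems(1)[of "y # us'"] by simp
    show "mset (us @ vs) = mset ys" using Cons.prems(2) xs by simp
  qed
  then show ?case using move xs by simp
qed

text \<open>
  This is the symmetry of Schur functions. The remaining work on symmetry concerns only the passage
  from monomials to lists of exponents.
\<close>
lemma kostka_mset:
  assumes "supported L \<kappa>" "mset \<gamma> = mset \<delta>"
  shows "kostka L \<kappa> \<gamma> = kostka L \<kappa> \<delta>"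
  using kostka_swap[OF assms(1)] assms(2) by (rule eq_if_mset_eq_of_adjacent_swaps[where f = "kostka L \<kappa>"])

section \<open>Lattice words and their runs\<close>

text \<open>
  A word lists the rows of the successive cells of a standard tableau, the last cell first. The
  condition says that every suffix has a partition as content, that is, every initial stage of the
  filling is a Young diagram.
\<close>
fun lattice_word :: "nat list \<Rightarrow> bool" where
  "lattice_word [] \<longleftrightarrow> True"
| "lattice_word (i # w) \<longleftrightarrow>
     lattice_word w \<and> (case i of 0 \<Rightarrow> True | Suc j \<Rightarrow> count_list w (Suc j) < count_list w j)"

text \<open>
  Within one horizontal strip the cells are added from left to right, hence from the bottom row
  upwards. Since words are read backwards, each block is weakly increasing.
\<close>
fun fits :: "nat list \<Rightarrow> nat list \<Rightarrow> bool" where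
  "fits [] w \<longleftrightarrow> w = []"
| "fits (a # \<gamma>) w \<longleftrightarrow> a \<le> length w \<and> sorted (take a w) \<and> fits \<gamma> (drop a w)"

definition lattice_words :: "(nat \<Rightarrow> nat) \<Rightarrow> nat list set" where
  "lattice_words \<kappa> = {w. lattice_word w \<and> count_list w = \<kappa>}"

text \<open>
  Only the inequalities \<open>\<kappa> (Suc i) \<le> \<rho> i\<close> matter, because prefixing can only enlarge the content. In a
  sorted prefix, row \<open>i\<close> has not grown yet when row \<open>Suc i\<close> receives its cells, so the lattice condition
  compares the new length of row \<open>Suc i\<close> with the old length of row \<open>i\<close>.
\<close>
lemma lattice_word_append_sorted:
  assumes "lattice_word w" "sorted v"
  shows "lattice_word (v @ w) \<longleftrightarrow> interlaces (count_list w) (count_list (v @ w))"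
  using assms(2)
proof (induction v)
  case Nil
  have "count_list w (Suc i) \<le> count_list w i" for i
    using assms(1)
  proof (induction w)
    case (Cons j w)
    then show ?case by (cases j) (auto simp: le_Suc_eq)
  qed simp
  then show ?case using assms(1) by (simp add: interlaces_def)
next
  case (Cons x v)
  have int: "interlaces (count_list w) (count_list (u @ w)) \<longleftrightarrow> (\<forall>i. count_list (u @ w) (Suc i) \<le> count_list w i)" for u
    by (simp add: interlaces_def)
  have IH: "lattice_word (v @ w) \<longleftrightarrow> (\<forall>i. count_list (v @ w) (Suc i) \<le> count_list w i)"
    unfolding int[symmetric] using Cons.prems by (intro Cons.IH) simp
  show ?case
  proof (cases x)
    case 0
    have "count_list ((x # v) @ w) (Suc i) = count_list (v @ w) (Suc i)" for i
      using 0 by simp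
    then show ?thesis unfolding int using IH 0 by simp
  next
    case (Suc j)
    have "j \<notin> set v" using Cons.prems Suc by fastforce
    then have j: "count_list (v @ w) j = count_list w j" by simp
    have count: "count_list ((x # v) @ w) (Suc i) = count_list (v @ w) (Suc i) + of_bool (i = j)" for i
      using Suc by simp
    have "lattice_word ((x # v) @ w) \<longleftrightarrow>
        lattice_word (v @ w) \<and> count_list (v @ w) (Suc j) < count_list w j"
      using Suc j by simp
    also have "\<dots> \<longleftrightarrow> (\<forall>i. count_list ((x # v) @ w) (Suc i) \<le> count_list w i)"
      unfolding IH count
    proof (intro iffI allI conjI)
      fix i assume "\<forall>i. count_list (v @ w) (Suc i) + of_bool (i = j) \<le> count_list w i"
      then show "count_list (v @ w) (Suc i) \<le> count_list w i" by (blast intro: add_leD1)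
    next
      assume "\<forall>i. count_list (v @ w) (Suc i) + of_bool (i = j) \<le> count_list w i"
      then have "count_list (v @ w) (Suc j) + of_bool (j = j) \<le> count_list w j" by blast
      then show "count_list (v @ w) (Suc j) < count_list w j" by simp
    qed (simp add: Suc_leI del: count_list_append)
    finally show ?thesis unfolding int .
  qed
qed

lemma length_eq_sum_counts:
  assumes "supported L (count_list w)"
  shows "length w = sum (count_list w) {..<L}"
proof -
  have "set w \<subseteq> {..<L}"
    using assms by (auto simp: supported_def) (metis count_list_0_iff leI)
  then show ?thesis by (simp add: sum_count_set)
qed

lemma finite_lattice_words [simp]:
  assumes "supported L \<kappa>"
  shows "finite (lattice_words \<kappa>)"
proof (rule finite_subset)
  show "lattice_words \<kappa> \<subseteq> {w. set w \<subseteq> {..<L} \<and> length w = sum \<kappa> {..<L}}"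
  proof clarify
    fix w assume w: "w \<in> lattice_words \<kappa>"
    then have "supported L (count_list w)" using assms by (simp add: lattice_words_def)
    moreover from this have "set w \<subseteq> {..<L}"
      by (auto simp: supported_def) (metis count_list_0_iff leI)
    ultimately show "set w \<subseteq> {..<L} \<and> length w = sum \<kappa> {..<L}"
      using w length_eq_sum_counts[of L w] by (auto simp: lattice_words_def)
  qed
  show "finite {w. set w \<subseteq> {..<L} \<and> length w = sum \<kappa> {..<L}}"
    by (rule finite_lists_length_eq) simp
qed

lemma ex_sorted_with_counts:
  assumes "supported L \<delta>"
  shows "\<exists>v. sorted v \<and> count_list v = \<delta>"
proof -
  have *: "count_list (concat (map (\<lambda>i. replicate (\<delta> i) i) [0..<n])) j = (if j < n then \<delta> j else 0)" for n j
  proof (induction n)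
    case (Suc n)
    have "count_list (replicate k i) j = (if i = j then k else 0)" for k i :: nat
      by (induction k) auto
    then show ?case using Suc by auto
  qed simp
  let ?v = "sort (concat (map (\<lambda>i. replicate (\<delta> i) i) [0..<L]))"
  have "count_list ?v j = count_list (concat (map (\<lambda>i. replicate (\<delta> i) i) [0..<L])) j" for j
    unfolding count_mset[symmetric] by simp
  then have "count_list ?v j = \<delta> j" for j
    using assms *[of L j] by (auto simp: supported_def)
  then show ?thesis by (intro exI[of _ ?v]) auto
qed

lemma sorted_eq_of_counts:
  fixes u v :: "nat list"
  assumes "sorted u" "sorted v" "count_list u = count_list v"
  shows "u = v"
proof -
  have "mset u = mset v" using assms(3) by (intro multiset_eqI) (simp add: count_mset)
  then show ?thesis using assms(1,2) by (metis properties_for_sort sorted_sort_id)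
qed

text \<open>
  A sorted block is determined by its content, so removing the first block of a word loses nothing
  once the remaining shape is known.
\<close>
lemma card_words_step:
  assumes "supported L \<kappa>"
  shows "bij_betw (\<lambda>w. (count_list (drop a w), drop a w))
     {w \<in> lattice_words \<kappa>. fits (a # \<gamma>) w}
     (Sigma (strip_removals L \<kappa> a) (\<lambda>\<rho>. {w \<in> lattice_words \<rho>. fits \<gamma> w}))"
  unfolding bij_betw_def
proof
  have split: "count_list w i = count_list (take a w) i + count_list (drop a w) i" for w :: "nat list" and i
    by (metis append_take_drop_id count_list_append)
  show "inj_on (\<lambda>w. (count_list (drop a w), drop a w)) {w \<in> lattice_words \<kappa>. fits (a # \<gamma>) w}"
  proof (rule inj_onI, clarsimp simp: lattice_words_def)
    fix w w' :: "nat list" assume eq: "drop a w = drop a w'" "count_list w' = count_list w"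
      "sorted (take a w)" "sorted (take a w')"
    have "count_list (take a w) i = count_list (take a w') i" for i
      using split[of w i] split[of w' i] eq by simp
    then have "take a w = take a w'" using eq by (intro sorted_eq_of_counts) auto
    then show "w = w'" using eq by (metis append_take_drop_id)
  qed
  show "(\<lambda>w. (count_list (drop a w), drop a w)) ` {w \<in> lattice_words \<kappa>. fits (a # \<gamma>) w} =
    Sigma (strip_removals L \<kappa> a) (\<lambda>\<rho>. {w \<in> lattice_words \<rho>. fits \<gamma> w})" (is "?f ` ?A = ?B")
  proof
    show "?f ` ?A \<subseteq> ?B"
    proof (clarsimp simp: lattice_words_def)
      fix w assume w: "lattice_word w" "\<kappa> = count_list w" "a \<le> length w" "sorted (take a w)"
      have lat: "lattice_word (drop n w)" for n
        using w(1) by (induction w arbitrary: n) (auto simp: drop_Cons split: nat.splits)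
      have int: "interlaces (count_list (drop a w)) (count_list w)"
        using lattice_word_append_sorted[OF lat w(4), of a] w(1) by simp
      have "length (drop a w) = sum (count_list (drop a w)) {..<L}"
        using int assms w(2) by (intro length_eq_sum_counts) (auto intro: interlaces_supported)
      then have "sum (count_list (drop a w)) {..<L} + a = sum (count_list w) {..<L}"
        using length_eq_sum_counts[of L w] assms w(2,3) by simp
      then show "count_list (drop a w) \<in> strip_removals L (count_list w) a \<and> lattice_word (drop a w)"
        using int lat by (simp add: strip_removals_def)
    qed
    show "?B \<subseteq> ?f ` ?A"
    proof clarify
      fix \<rho> w assume \<rho>: "\<rho> \<in> strip_removals L \<kappa> a" and w: "w \<in> lattice_words \<rho>" "fits \<gamma> w"
      have "supported L (\<lambda>i. \<kappa> i - \<rho> i)" using assms by (simp add: supported_def)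
      then obtain v where v: "sorted v" "count_list v = (\<lambda>i. \<kappa> i - \<rho> i)"
        using ex_sorted_with_counts by blast
      have int: "interlaces \<rho> \<kappa>" and sum: "sum \<rho> {..<L} + a = sum \<kappa> {..<L}"
        using \<rho> by (auto simp: strip_removals_def)
      have cw: "count_list w = \<rho>" and lw: "lattice_word w" using w by (auto simp: lattice_words_def)
      have cv: "count_list (v @ w) = \<kappa>"
        using int by (auto simp: v(2) cw interlaces_def)
      have "length (v @ w) = sum \<kappa> {..<L}" "length w = sum \<rho> {..<L}"
        using length_eq_sum_counts[of L "v @ w"] length_eq_sum_counts[of L w]
          assms cv cw interlaces_supported[OF int assms] by auto
      then have "length v = a" using sum by simp
      moreover have "lattice_word (v @ w)"
        using lattice_word_append_sorted[OF lw v(1)] cv cw int by simp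
      ultimately have "v @ w \<in> ?A" "?f (v @ w) = (\<rho>, w)"
        using cv cw w v by (auto simp: lattice_words_def)
      then show "(\<rho>, w) \<in> ?f ` ?A" by force
    qed
  qed
qed

lemma kostka_eq_card_words:
  assumes "supported L \<kappa>"
  shows "kostka L \<kappa> \<gamma> = card {w \<in> lattice_words \<kappa>. fits \<gamma> w}"
  using assms
proof (induction \<gamma> arbitrary: \<kappa>)
  case Nil
  have "{w \<in> lattice_words \<kappa>. fits [] w} = (if \<kappa> = (\<lambda>_. 0) then {[]} else {})"
    by (auto simp: lattice_words_def fun_eq_iff)
  then show ?case by simp
next
  case (Cons a \<gamma>)
  have fin: "\<forall>\<rho>\<in>strip_removals L \<kappa> a. finite {w \<in> lattice_words \<rho>. fits \<gamma> w}"
    using Cons.prems strip_removals_supported by (metis (no_types, lifting) finite_lattice_words finite_subset mem_Collect_eq subsetI)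
  have "card {w \<in> lattice_words \<kappa>. fits (a # \<gamma>) w}
      = (\<Sum>\<rho>\<in>strip_removals L \<kappa> a. card {w \<in> lattice_words \<rho>. fits \<gamma> w})"
    using bij_betw_same_card[OF card_words_step[OF Cons.prems]] card_SigmaI[OF finite_strip_removals[OF Cons.prems] fin]
    by simp
  also have "\<dots> = kostka L \<kappa> (a # \<gamma>)"
    using Cons strip_removals_supported by (auto intro!: sum.cong)
  finally show ?case by simp
qed

text \<open>
  Lengths of the maximal weakly increasing runs. As words are read backwards, this is the reverse of
  the descent composition of the corresponding standard tableau.
\<close>
fun runs :: "nat list \<Rightarrow> nat list" where
  "runs [] = []"
| "runs [x] = [1]"
| "runs (x # y # w) = (if x \<le> y then Suc (hd (runs (y # w))) # tl (runs (y # w)) else 1 # runs (y # w))"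

lemma runs_eq_Nil_iff [simp]: "runs w = [] \<longleftrightarrow> w = []"
  by (induction w rule: runs.induct) auto

lemma composition_runs: "composition (runs w)"
proof (induction w rule: runs.induct)
  case (3 x y w)
  then show ?case by (cases "runs (y # w)") (auto simp: composition_def)
qed (auto simp: composition_def)

lemma sum_list_runs: "sum_list (runs w) = length w"
proof (induction w rule: runs.induct)
  case (3 x y w)
  then show ?case by (cases "runs (y # w)") auto
qed auto

lemma runs_append_sorted:
  assumes "sorted v" "v \<noteq> []"
  shows "runs (v @ w) = (if w = [] \<or> hd w < last v then length v # runs w
     else (length v + hd (runs w)) # tl (runs w))"
  using assms
proof (induction v rule: runs.induct)
  case (2 x)
  then show ?case by (cases w) auto
qed auto

lemma runs_drop:
  assumes "runs w = c # \<beta>" "0 < a" "a \<le> c"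
  shows "a \<le> length w \<and> sorted (take a w) \<and> runs (drop a w) = (if a = c then \<beta> else (c - a) # \<beta>)"
  using assms
proof (induction w arbitrary: a c \<beta> rule: runs.induct)
  case (2 x)
  then have "a = 1" "c = 1" "\<beta> = []" by auto
  then show ?case by simp
next
  case (3 x y w)
  obtain r rs where r: "runs (y # w) = r # rs" by (cases "runs (y # w)") auto
  obtain a' where a: "a = Suc a'" using \<open>0 < a\<close> by (cases a) auto
  show ?case
  proof (cases "x \<le> y")
    case False
    then show ?thesis using 3 a r by auto
  next
    case True
    have c: "c = Suc r" "\<beta> = rs" using "3.prems"(1) r True by auto
    have "0 < r" using composition_runs[of "y # w"] r by (simp add: composition_def)
    show ?thesis
    proof (cases a')
      case 0
      then show ?thesis using a c r \<open>0 < r\<close> by auto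
    next
      case (Suc a'')
      have "a' \<le> length (y # w) \<and> sorted (take a' (y # w)) \<and>
          runs (drop a' (y # w)) = (if a' = r then rs else (r - a') # rs)"
        using "3.IH"(1)[OF True r, of a'] "3.prems"(3) a c Suc by simp
      then show ?thesis using True a c Suc by auto
    qed
  qed
qed auto

lemma refines_Nil_left [simp]: "refines [] \<beta> \<longleftrightarrow> \<beta> = []"
proof -
  have "[] \<notin> set bs \<Longrightarrow> concat bs = [] \<Longrightarrow> bs = []" for bs :: "nat list list"
    by (cases bs) auto
  then show ?thesis by (auto simp: refines_def composition_def)
qed

text \<open>
  The head of the finer composition is either a whole block or the beginning of a longer one. This
  turns refinement into a recursion on the finer composition.
\<close>
lemma refines_Cons_iff:
  "refines (a # \<gamma>) \<beta> \<longleftrightarrow> 0 < a \<and>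
     ((\<exists>\<beta>'. \<beta> = a # \<beta>' \<and> refines \<gamma> \<beta>') \<or> (\<exists>r \<beta>'. \<beta> = (a + r) # \<beta>' \<and> 0 < r \<and> refines \<gamma> (r # \<beta>')))"
    (is "?L \<longleftrightarrow> ?R")
proof
  assume ?L
  then obtain bs where bs: "composition (a # \<gamma>)" "[] \<notin> set bs" "concat bs = a # \<gamma>" "map sum_list bs = \<beta>"
    by (auto simp: refines_def)
  then obtain b bs' where b: "bs = (a # b) # bs'"
    by (cases bs; cases "hd bs") auto
  have comp: "0 < a" "composition \<gamma>" using bs by (auto simp: composition_def)
  show ?R
  proof (cases b)
    case Nil
    then show ?thesis using bs b comp by (auto simp: refines_def)
  next
    case (Cons c b')
    have "0 < sum_list b" using bs b Cons by (auto simp: composition_def)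
    moreover have "refines \<gamma> (sum_list b # map sum_list bs')"
      using bs b comp Cons unfolding refines_def by (intro conjI exI[of _ "b # bs'"]) auto
    ultimately show ?thesis using bs b comp by auto
  qed
next
  assume r: ?R
  then consider \<beta>' where "\<beta> = a # \<beta>'" "refines \<gamma> \<beta>'"
    | r \<beta>' where "\<beta> = (a + r) # \<beta>'" "refines \<gamma> (r # \<beta>')" by blast
  then show ?L
  proof cases
    case 1
    then obtain bs where "composition \<gamma>" "[] \<notin> set bs" "concat bs = \<gamma>" "map sum_list bs = \<beta>'"
      by (auto simp: refines_def)
    then show ?thesis using r 1 unfolding refines_def
      by (intro conjI exI[of _ "[a] # bs"]) (auto simp: composition_def)
  next
    case 2
    then obtain b bs where "composition \<gamma>" "[] \<notin> set (b # bs)" "concat (b # bs) = \<gamma>"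
      "map sum_list (b # bs) = r # \<beta>'"
      by (auto simp: refines_def map_eq_Cons_conv)
    then show ?thesis using r 2 unfolding refines_def
      by (intro conjI exI[of _ "(a # b) # bs"]) (auto simp: composition_def)
  qed
qed

text \<open>
  Sorted blocks are exactly the pieces obtained by cutting up the maximal runs.
\<close>
lemma fits_iff_refines:
  assumes "composition \<gamma>"
  shows "fits \<gamma> w \<longleftrightarrow> refines \<gamma> (runs w)"
  using assms
proof (induction \<gamma> arbitrary: w)
  case (Cons a \<gamma>)
  have a: "0 < a" and IH: "fits \<gamma> w \<longleftrightarrow> refines \<gamma> (runs w)" for w
    using Cons by (auto simp: composition_def)
  show ?case
  proof
    assume f: "fits (a # \<gamma>) w"
    define v u where "v = take a w" and "u = drop a w"
    have w: "w = v @ u" "length v = a" "v \<noteq> []" "sorted v" "refines \<gamma> (runs u)"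
      using f a IH by (auto simp: v_def u_def)
    show "refines (a # \<gamma>) (runs w)"
    proof (cases "u = [] \<or> hd u < last v")
      case True
      then show ?thesis using runs_append_sorted[OF w(4,3), of u] w a by (simp add: refines_Cons_iff)
    next
      case False
      then obtain r rs where r: "runs u = r # rs" by (cases "runs u") auto
      then have "0 < r" using composition_runs[of u] by (simp add: composition_def)
      then show ?thesis using False runs_append_sorted[OF w(4,3), of u] w a r
        by (simp add: refines_Cons_iff)
    qed
  next
    assume "refines (a # \<gamma>) (runs w)"
    then consider \<beta>' where "runs w = a # \<beta>'" "refines \<gamma> \<beta>'"
      | r \<beta>' where "runs w = (a + r) # \<beta>'" "0 < r" "refines \<gamma> (r # \<beta>')"
      unfolding refines_Cons_iff by blast
    then show "fits (a # \<gamma>) w"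
    proof cases
      case 1
      then show ?thesis using runs_drop[of w a \<beta>' a] a IH by simp
    next
      case 2
      then show ?thesis using runs_drop[of w "a + r" \<beta>' a] a IH by simp
    qed
  qed
qed auto

lemma refines_rev_iff: "refines (rev \<gamma>) \<beta> \<longleftrightarrow> refines \<gamma> (rev \<beta>)"
proof -
  have *: "refines (rev \<gamma>) (rev \<beta>)" if ref: "refines \<gamma> \<beta>" for \<gamma> \<beta>
  proof -
    obtain bs where "composition \<gamma>" "[] \<notin> set bs" "concat bs = \<gamma>" "map sum_list bs = \<beta>"
      using ref by (auto simp: refines_def)
    then show ?thesis unfolding refines_def
      by (intro conjI exI[of _ "rev (map rev bs)"])
        (auto simp: composition_def rev_concat rev_map o_def)
  qed
  show ?thesis using *[of \<gamma> "rev \<beta>"] *[of "rev \<gamma>" \<beta>] by auto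
qed

section \<open>Monomials and the fundamental basis\<close>

text \<open>
  The nonzero exponents in the order of the variables. Quasisymmetric functions see nothing else of
  a monomial.
\<close>
definition weights :: "monomial \<Rightarrow> nat list" where
  "weights m = map (Poly_Mapping.lookup m) (sorted_list_of_set (Poly_Mapping.keys m))"

lemma lookup_sum_list: "Poly_Mapping.lookup (sum_list ms) k = (\<Sum>m\<leftarrow>ms. Poly_Mapping.lookup m k)"
  by (induction ms) (auto simp: lookup_add)

lemma lookup_product_notin:
  assumes "length is = length \<gamma>" "k \<notin> set is"
  shows "Poly_Mapping.lookup (sum_list (map2 Poly_Mapping.single is \<gamma>)) k = (0 :: nat)"
  using assms by (induction "is" \<gamma> rule: list_induct2) (auto simp: lookup_add lookup_single)

lemma lookup_product:
  assumes "length is = length \<gamma>" "distinct is"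
  shows "map (Poly_Mapping.lookup (sum_list (map2 Poly_Mapping.single is \<gamma>))) is = (\<gamma> :: nat list)"
  using assms
proof (induction "is" \<gamma> rule: list_induct2)
  case (Cons i "is" a \<gamma>)
  let ?m = "sum_list (map2 Poly_Mapping.single is \<gamma>)"
  have "map (Poly_Mapping.lookup (Poly_Mapping.single i a + ?m)) is = map (Poly_Mapping.lookup ?m) is"
    using Cons.prems by (intro map_cong refl) (auto simp: lookup_add lookup_single when_def)
  then have "map (Poly_Mapping.lookup (Poly_Mapping.single i a + ?m)) is = \<gamma>"
    using Cons.IH Cons.prems by (simp only: distinct.simps)
  then show ?case using Cons.hyps Cons.prems lookup_product_notin[of "is" \<gamma> i]
    by (simp add: lookup_add[of _ _ i])
qed simp

lemma keys_product:
  assumes "length is = length \<gamma>" "distinct is" "composition \<gamma>"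
  shows "Poly_Mapping.keys (sum_list (map2 Poly_Mapping.single is \<gamma>)) = set is"
proof -
  let ?m = "sum_list (map2 Poly_Mapping.single is \<gamma>)"
  have "Poly_Mapping.lookup ?m i \<noteq> 0" if "i \<in> set is" for i
  proof -
    have "Poly_Mapping.lookup ?m i \<in> set (map (Poly_Mapping.lookup ?m) is)" using that by simp
    then show ?thesis unfolding lookup_product[OF assms(1,2)] using assms(3) by (auto simp: composition_def)
  qed
  then show ?thesis using lookup_product_notin[OF assms(1)]
    by (auto simp: in_keys_iff)
qed

lemma sum_over_keys: "sum_list (map2 Poly_Mapping.single (sorted_list_of_set (Poly_Mapping.keys m)) (weights m)) = m"
proof (rule poly_mapping_eqI)
  fix k
  let ?is = "sorted_list_of_set (Poly_Mapping.keys m)"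
  let ?m = "sum_list (map2 Poly_Mapping.single ?is (weights m))"
  show "Poly_Mapping.lookup ?m k = Poly_Mapping.lookup m k"
  proof (cases "k \<in> set ?is")
    case True
    have "map (Poly_Mapping.lookup ?m) ?is = map (Poly_Mapping.lookup m) ?is"
      using lookup_product[of ?is "weights m"] by (simp add: weights_def)
    then show ?thesis using True by (metis map_eq_conv)
  next
    case False
    then show ?thesis
      using lookup_product_notin[of ?is "weights m" k] by (simp add: weights_def in_keys_iff)
  qed
qed

lemma weights_product:
  assumes "length is = length \<gamma>" "sorted_wrt (<) is" "composition \<gamma>"
  shows "sorted_list_of_set (Poly_Mapping.keys (sum_list (map2 Poly_Mapping.single is \<gamma>))) = is"
    "weights (sum_list (map2 Poly_Mapping.single is \<gamma>)) = \<gamma>"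
proof -
  have d: "distinct is" using assms(2) strict_sorted_iff by blast
  show *: "sorted_list_of_set (Poly_Mapping.keys (sum_list (map2 Poly_Mapping.single is \<gamma>))) = is"
    using assms d by (simp add: keys_product strict_sorted_iff sorted_list_of_set.idem_if_sorted_distinct)
  show "weights (sum_list (map2 Poly_Mapping.single is \<gamma>)) = \<gamma>"
    unfolding weights_def * using assms(1) d by (rule lookup_product)
qed

lemma composition_weights: "composition (weights m)"
  by (auto simp: composition_def weights_def in_keys_iff)

lemma sum_list_weights: "sum_list (weights m) = total_degree m"
  unfolding weights_def total_degree_def by (simp add: sum_list_distinct_conv_sum_set)

text \<open>
  A representative monomial for each composition of exponents.
\<close>
definition dominant_monomial :: "nat list \<Rightarrow> monomial" where
  "dominant_monomial \<gamma> = sum_list (map2 Poly_Mapping.single [0..<length \<gamma>] \<gamma>)"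

lemma weights_dominant_monomial [simp]: "composition \<gamma> \<Longrightarrow> weights (dominant_monomial \<gamma>) = \<gamma>"
  unfolding dominant_monomial_def by (intro weights_product) auto

text \<open>
  The index sequence is forced: it is the sorted list of the variables of the monomial.
\<close>
lemma monomial_qsym_apply:
  assumes "composition \<gamma>"
  shows "monomial_qsym \<gamma> m = of_bool (weights m = \<gamma>)"
proof -
  let ?I = "{is. length is = length \<gamma> \<and> sorted_wrt (<) is \<and> sum_list (map2 Poly_Mapping.single is \<gamma>) = m}"
  have only: "is = sorted_list_of_set (Poly_Mapping.keys m) \<and> weights m = \<gamma>" if "is \<in> ?I" for "is"
    using weights_product[of "is", OF _ _ assms] that by simp
  have "?I = (if weights m = \<gamma> then {sorted_list_of_set (Poly_Mapping.keys m)} else {})"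
  proof (cases "weights m = \<gamma>")
    case True
    have "length (sorted_list_of_set (Poly_Mapping.keys m)) = length (weights m)"
      by (simp add: weights_def)
    then have "sorted_list_of_set (Poly_Mapping.keys m) \<in> ?I"
      using sum_over_keys[of m] strict_sorted_list_of_set True by blast
    then have "?I = {sorted_list_of_set (Poly_Mapping.keys m)}" using only by blast
    then show ?thesis using True by simp
  next
    case False
    then have "?I = {}" using only by blast
    then show ?thesis using False by simp
  qed
  then show ?thesis by (simp add: monomial_qsym_def)
qed

lemma refines_composition:
  assumes "refines \<gamma> \<beta>"
  shows "composition \<gamma>" "composition \<beta>" "sum_list \<gamma> = sum_list \<beta>" "length \<beta> \<le> length \<gamma>"
    "length \<beta> = length \<gamma> \<Longrightarrow> \<beta> = \<gamma>"
proof -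
  show "composition \<gamma>" using assms by (simp add: refines_def)
  have "composition \<beta> \<and> sum_list \<gamma> = sum_list \<beta> \<and> length \<beta> \<le> length \<gamma> \<and> (length \<beta> = length \<gamma> \<longrightarrow> \<beta> = \<gamma>)"
    using assms
  proof (induction \<gamma> arbitrary: \<beta>)
    case (Cons a \<gamma>)
    from Cons.prems consider \<beta>' where "\<beta> = a # \<beta>'" "refines \<gamma> \<beta>'"
      | r \<beta>' where "\<beta> = (a + r) # \<beta>'" "0 < r" "refines \<gamma> (r # \<beta>')"
      unfolding refines_Cons_iff by blast
    then show ?case
    proof cases
      case 1
      then show ?thesis using Cons.IH[OF 1(2)] Cons.prems by (auto simp: composition_def refines_Cons_iff)
    next
      case 2
      then show ?thesis using Cons.IH[OF 2(3)] by (auto simp: composition_def)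
    qed
  qed (simp add: composition_def)
  then show "composition \<beta>" "sum_list \<gamma> = sum_list \<beta>" "length \<beta> \<le> length \<gamma>"
    "length \<beta> = length \<gamma> \<Longrightarrow> \<beta> = \<gamma>" by auto
qed

lemma refines_refl: "composition \<gamma> \<Longrightarrow> refines \<gamma> \<gamma>"
  by (induction \<gamma>) (auto simp: refines_Cons_iff composition_def)

lemma finite_compositions: "finite {\<gamma>. composition \<gamma> \<and> sum_list \<gamma> = n}"
proof (rule finite_subset)
  show "{\<gamma>. composition \<gamma> \<and> sum_list \<gamma> = n} \<subseteq> {\<gamma>. set \<gamma> \<subseteq> {..n} \<and> length \<gamma> \<le> n}"
  proof clarify
    fix \<gamma> :: "nat list" assume "composition \<gamma>" "n = sum_list \<gamma>"
    moreover from this(1) have "length \<gamma> \<le> sum_list \<gamma>"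
      by (induction \<gamma>) (auto simp: composition_def)
    ultimately show "set \<gamma> \<subseteq> {..sum_list \<gamma>} \<and> length \<gamma> \<le> sum_list \<gamma>"
      by (auto intro: member_le_sum_list)
  qed
qed (rule finite_lists_length_le, simp)

lemma sum_apply: "sum f A x = (\<Sum>a\<in>A. f a x)"
  for f :: "'a \<Rightarrow> 'b \<Rightarrow> 'c :: comm_monoid_add"
  by (induction A rule: infinite_finite_induct) auto

lemma fundamental_qsym_apply: "fundamental_qsym \<alpha> m = of_bool (refines (weights m) \<alpha>)"
proof -
  have "finite {\<gamma>. refines \<gamma> \<alpha>}"
    by (rule finite_subset[OF _ finite_compositions[of "sum_list \<alpha>"]]) (auto simp: refines_composition)
  moreover have "fundamental_qsym \<alpha> m = (\<Sum>\<gamma> | refines \<gamma> \<alpha>. of_bool (weights m = \<gamma>))"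
    unfolding fundamental_qsym_def sum_apply
    by (intro sum.cong) (auto simp: monomial_qsym_apply refines_composition)
  ultimately show ?thesis by (simp add: of_bool_def)
qed

section \<open>Semistandard tableaux as chains of shapes\<close>

definition tableaux :: "nat \<Rightarrow> (nat \<Rightarrow> nat) \<Rightarrow> monomial \<Rightarrow> nat list list set" where
  "tableaux L \<kappa> m = {T. ssyt (map \<kappa> [0..<L]) T \<and> tableau_monomial T = m}"

lemma ssyt_shape_iff:
  "ssyt (map \<kappa> [0..<L]) T \<longleftrightarrow> length T = L \<and> (\<forall>i<L. length (T ! i) = \<kappa> i \<and> sorted (T ! i)) \<and>
     (\<forall>i j. Suc i < L \<and> j < \<kappa> (Suc i) \<longrightarrow> T ! i ! j < T ! Suc i ! j)"
proof -
  have "map length T = map \<kappa> [0..<L] \<longleftrightarrow> length T = L \<and> (\<forall>i<L. length (T ! i) = \<kappa> i)"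
  proof
    assume eq: "map length T = map \<kappa> [0..<L]"
    then have len: "length T = L" by (metis length_map length_upt minus_nat.diff_0)
    moreover have "length (T ! i) = \<kappa> i" if "i < L" for i
      using arg_cong[OF eq, of "\<lambda>xs. xs ! i"] that len by simp
    ultimately show "length T = L \<and> (\<forall>i<L. length (T ! i) = \<kappa> i)" by blast
  qed (auto intro!: nth_equalityI)
  then have "ssyt (map \<kappa> [0..<L]) T \<longleftrightarrow> (length T = L \<and> (\<forall>i<L. length (T ! i) = \<kappa> i)) \<and> (\<forall>i<length T. sorted (T ! i)) \<and>
     (\<forall>i j. Suc i < length T \<and> j < length (T ! Suc i) \<longrightarrow> T ! i ! j < T ! Suc i ! j)"
    unfolding ssyt_def all_set_conv_all_nth by simp
  also have "\<dots> \<longleftrightarrow> length T = L \<and> (\<forall>i<L. length (T ! i) = \<kappa> i \<and> sorted (T ! i)) \<and>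
     (\<forall>i j. Suc i < L \<and> j < \<kappa> (Suc i) \<longrightarrow> T ! i ! j < T ! Suc i ! j)"
    by (rule iffI; elim conjE; (intro conjI allI impI)?; (elim conjE)?; simp)
  finally show ?thesis .
qed

lemma lookup_tableau_monomial:
  "Poly_Mapping.lookup (tableau_monomial T) v = (\<Sum>i<length T. count_list (T ! i) v)"
proof -
  have *: "(\<Sum>k\<leftarrow>xs. Poly_Mapping.lookup (Poly_Mapping.single k 1) v) = count_list xs v" for xs
    by (induction xs) (auto simp: lookup_single)
  have "Poly_Mapping.lookup (tableau_monomial T) v = count_list (concat T) v"
    using * by (simp add: tableau_monomial_def lookup_sum_list o_def)
  also have "\<dots> = (\<Sum>r\<leftarrow>T. count_list r v)" by (induction T) auto
  finally show ?thesis by (simp add: sum_list_sum_nth atLeast0LessThan)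
qed

lemma tableaux_iff:
  "T \<in> tableaux L \<kappa> m \<longleftrightarrow> length T = L \<and> (\<forall>i<L. length (T ! i) = \<kappa> i \<and> sorted (T ! i)) \<and>
     (\<forall>i j. Suc i < L \<and> j < \<kappa> (Suc i) \<longrightarrow> T ! i ! j < T ! Suc i ! j) \<and>
     (\<forall>v. (\<Sum>i<L. count_list (T ! i) v) = Poly_Mapping.lookup m v)"
proof -
  have "tableau_monomial T = m \<longleftrightarrow> (\<forall>v. (\<Sum>i<length T. count_list (T ! i) v) = Poly_Mapping.lookup m v)"
    by (metis lookup_tableau_monomial poly_mapping_eqI)
  then show ?thesis by (auto simp: tableaux_def ssyt_shape_iff)
qed

lemma tableaux_entries:
  assumes "T \<in> tableaux L \<kappa> m" "i < L"
  shows "set (T ! i) \<subseteq> Poly_Mapping.keys m"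
proof
  fix v assume "v \<in> set (T ! i)"
  then have "0 < count_list (T ! i) v" by (metis count_list_0_iff gr0I)
  also have "\<dots> \<le> (\<Sum>i<L. count_list (T ! i) v)" using assms(2) by (intro member_le_sum) auto
  finally show "v \<in> Poly_Mapping.keys m" using assms(1) by (simp add: tableaux_iff in_keys_iff)
qed

lemma finite_tableaux: "finite (tableaux L \<kappa> m)"
proof (rule finite_subset)
  let ?R = "{r. set r \<subseteq> Poly_Mapping.keys m \<and> length r \<le> sum \<kappa> {..<L}}"
  show "tableaux L \<kappa> m \<subseteq> {T. set T \<subseteq> ?R \<and> length T = L}"
  proof clarify
    fix T assume T: "T \<in> tableaux L \<kappa> m"
    have "\<kappa> i \<le> sum \<kappa> {..<L}" if "i < L" for i
      using that by (intro member_le_sum) auto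
    then show "set T \<subseteq> ?R \<and> length T = L"
      using tableaux_entries[OF T] T by (fastforce simp: tableaux_iff in_set_conv_nth)
  qed
  show "finite {T. set T \<subseteq> ?R \<and> length T = L}"
    by (intro finite_lists_length_eq finite_lists_length_le) simp
qed

lemma sorted_split_maximum:
  assumes "sorted r" "\<forall>x\<in>set r. x \<le> (k :: nat)"
  shows "filter (\<lambda>x. x < k) r @ replicate (length r - length (filter (\<lambda>x. x < k) r)) k = r"
  using assms
proof (induction r)
  case (Cons x r)
  show ?case
  proof (cases "x < k")
    case False
    then have "\<forall>y\<in>set (x # r). y = k" using Cons.prems by fastforce
    moreover from this have "filter (\<lambda>x. x < k) (x # r) = []" by (auto simp: filter_empty_conv)
    moreover from calculation(1) have "replicate (length (x # r)) k = x # r" by (intro replicate_length_same) simp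
    ultimately show ?thesis by (simp only: length_0_conv list.size append_Nil minus_nat.diff_0)
  qed (use Cons in auto)
qed simp

definition truncate :: "nat \<Rightarrow> nat list list \<Rightarrow> nat list list" where
  "truncate k T = map (filter (\<lambda>x. x < k)) T"

definition shape_of :: "nat list list \<Rightarrow> nat \<Rightarrow> nat" where
  "shape_of T i = (if i < length T then length (T ! i) else 0)"

definition extend :: "nat \<Rightarrow> nat \<Rightarrow> (nat \<Rightarrow> nat) \<Rightarrow> nat list list \<Rightarrow> nat list list" where
  "extend L k \<kappa> T = map (\<lambda>i. T ! i @ replicate (\<kappa> i - length (T ! i)) k) [0..<L]"

text \<open>
  The cells holding the largest entry \<open>k\<close> form a horizontal strip. A row ends with its copies of \<open>k\<close>, and
  if row \<open>Suc i\<close> were longer than the truncated row \<open>i\<close>, the cell of row \<open>i\<close> just behind the truncation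
  would hold \<open>k\<close> and lie above an entry of at most \<open>k\<close>.
\<close>
lemma truncate_tableau:
  assumes "antimono \<kappa>" "supported L \<kappa>" "Poly_Mapping.keys m \<subseteq> {..<k}"
    and T: "T \<in> tableaux L \<kappa> (m + Poly_Mapping.single k a)"
  shows "extend L k \<kappa> (truncate k T) = T"
    "shape_of (truncate k T) \<in> strip_removals L \<kappa> a"
    "truncate k T \<in> tableaux L (shape_of (truncate k T)) m"
proof -
  define \<rho> where "\<rho> = shape_of (truncate k T)"
  have len: "length T = L" and row: "\<And>i. i < L \<Longrightarrow> length (T ! i) = \<kappa> i" "\<And>i. i < L \<Longrightarrow> sorted (T ! i)"
    and col: "\<And>i j. Suc i < L \<Longrightarrow> j < \<kappa> (Suc i) \<Longrightarrow> T ! i ! j < T ! Suc i ! j"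
    and content: "\<And>v. (\<Sum>i<L. count_list (T ! i) v) = Poly_Mapping.lookup (m + Poly_Mapping.single k a) v"
    using T by (auto simp: tableaux_iff)
  have nth: "truncate k T ! i = filter (\<lambda>x. x < k) (T ! i)" if "i < L" for i
    using that len by (simp add: truncate_def)
  have le_k: "x \<le> k" if "i < L" "x \<in> set (T ! i)" for i x
    using tableaux_entries[OF T that(1)] that(2) assms(3) keys_add[of m "Poly_Mapping.single k a"]
    by (force split: if_splits)
  have split: "T ! i = filter (\<lambda>x. x < k) (T ! i) @ replicate (\<kappa> i - \<rho> i) k"
    and \<rho>: "\<rho> i = length (filter (\<lambda>x. x < k) (T ! i))" if "i < L" for i
    using sorted_split_maximum[OF row(2), of i k] le_k row(1) that len
    by (auto simp: \<rho>_def shape_of_def nth) (simp_all add: truncate_def)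
  show "extend L k \<kappa> (truncate k T) = T"
  proof (rule nth_equalityI)
    fix i assume "i < length (extend L k \<kappa> (truncate k T))"
    then have i: "i < L" by (simp add: extend_def)
    then show "extend L k \<kappa> (truncate k T) ! i = T ! i"
      using split[OF i] \<rho>[OF i] by (simp add: extend_def nth)
  qed (simp add: extend_def len)
  have \<rho>0: "\<rho> i = 0" if "L \<le> i" for i
    using that len by (simp add: \<rho>_def shape_of_def truncate_def)
  have \<rho>le: "\<rho> i \<le> \<kappa> i" for i
    using \<rho>0 \<rho>[of i] row(1)[of i] length_filter_le[of _ "T ! i"] by (cases "i < L") auto
  have small: "T ! i ! j < k \<longleftrightarrow> j < \<rho> i" if "i < L" "j < \<kappa> i" for i j
  proof -
    have "T ! i ! j = (filter (\<lambda>x. x < k) (T ! i) @ replicate (\<kappa> i - \<rho> i) k) ! j"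
      using split[OF that(1)] by simp
    also have "\<dots> = (if j < \<rho> i then filter (\<lambda>x. x < k) (T ! i) ! j else k)"
      using that \<rho> by (simp add: nth_append)
    finally show ?thesis using nth_mem[of j "filter (\<lambda>x. x < k) (T ! i)"] \<rho>[OF that(1)] by auto
  qed
  have int: "\<kappa> (Suc i) \<le> \<rho> i" for i
  proof (rule ccontr)
    assume less: "\<not> ?thesis"
    then have "Suc i < L" using assms(2) by (metis leI le0 supported_def)
    moreover have "\<rho> i < \<kappa> i" using less assms(1) decseq_SucD[of \<kappa> i] by simp
    ultimately have "T ! i ! \<rho> i < T ! Suc i ! \<rho> i" "T ! Suc i ! \<rho> i \<le> k" "\<not> T ! i ! \<rho> i < k"
      using col[of i "\<rho> i"] less le_k[of "Suc i"] row(1)[of "Suc i"] small[of i "\<rho> i"] by auto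
    then show False by simp
  qed
  have rest: "sum \<rho> {..<L} + a = sum \<kappa> {..<L}"
  proof -
    have "count_list (T ! i) k = \<kappa> i - \<rho> i" if "i < L" for i
    proof -
      have "count_list (replicate n k) k = n" for n by (induction n) auto
      then show ?thesis by (subst split[OF that]) (simp add: count_notin)
    qed
    then have "(\<Sum>i<L. \<kappa> i - \<rho> i) = Poly_Mapping.lookup (m + Poly_Mapping.single k a) k"
      unfolding content[symmetric] by (auto intro: sum.cong)
    also have "\<dots> = a" using assms(3) by (auto simp: lookup_add in_keys_iff)
    finally have "(\<Sum>i<L. \<kappa> i - \<rho> i) = a" .
    then have "sum \<rho> {..<L} + a = (\<Sum>i<L. \<rho> i + (\<kappa> i - \<rho> i))" by (simp add: sum.distrib)
    also have "\<dots> = sum \<kappa> {..<L}" using \<rho>le by (intro sum.cong) auto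
    finally show ?thesis .
  qed
  show "shape_of (truncate k T) \<in> strip_removals L \<kappa> a"
    using int \<rho>le rest unfolding \<rho>_def[symmetric] by (simp add: strip_removals_def interlaces_def)
  have "(\<Sum>i<L. count_list (truncate k T ! i) v) = Poly_Mapping.lookup m v" for v
  proof -
    have "count_list (filter (\<lambda>x. x < k) r) v = (if v < k then count_list r v else 0)" for r
      by (induction r) auto
    then have "(\<Sum>i<L. count_list (truncate k T ! i) v) = (if v < k then \<Sum>i<L. count_list (T ! i) v else 0)"
      by (simp add: nth)
    then show ?thesis using content[of v] assms(3) by (auto simp: lookup_add lookup_single in_keys_iff)
  qed
  moreover have "truncate k T ! i ! j < truncate k T ! Suc i ! j" if "Suc i < L" "j < \<rho> (Suc i)" for i j
  proof -
    have "T ! i' ! j = truncate k T ! i' ! j" if "i' < L" "j < \<rho> i'" for i'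
      using that \<rho> nth by (subst split[OF that(1)]) (simp add: nth_append)
    moreover have "j < \<kappa> (Suc i)" "j < \<rho> i" using that \<rho>le[of "Suc i"] int[of i] by auto
    ultimately show ?thesis using that col[of i j] by simp
  qed
  ultimately show "truncate k T \<in> tableaux L (shape_of (truncate k T)) m"
    unfolding \<rho>_def[symmetric] using len row(2)
    by (auto simp: tableaux_iff \<rho> nth sorted_wrt_filter) (simp add: truncate_def)
qed

text \<open>
  Conversely, appending copies of \<open>k\<close> to the rows keeps the columns strict: by interlacing, every new
  cell lies below a cell of the old shape, whose entry is smaller than \<open>k\<close>.
\<close>
lemma extend_tableau:
  assumes "supported L \<kappa>" "Poly_Mapping.keys m \<subseteq> {..<k}" "\<rho> \<in> strip_removals L \<kappa> a"
    and T: "T \<in> tableaux L \<rho> m"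
  shows "truncate k (extend L k \<kappa> T) = T" "shape_of T = \<rho>"
    "extend L k \<kappa> T \<in> tableaux L \<kappa> (m + Poly_Mapping.single k a)"
proof -
  have len: "length T = L" and row: "\<And>i. i < L \<Longrightarrow> length (T ! i) = \<rho> i" "\<And>i. i < L \<Longrightarrow> sorted (T ! i)"
    and col: "\<And>i j. Suc i < L \<Longrightarrow> j < \<rho> (Suc i) \<Longrightarrow> T ! i ! j < T ! Suc i ! j"
    and content: "\<And>v. (\<Sum>i<L. count_list (T ! i) v) = Poly_Mapping.lookup m v"
    using T by (auto simp: tableaux_iff)
  have le: "\<rho> i \<le> \<kappa> i" "\<kappa> (Suc i) \<le> \<rho> i" for i
    using assms(3) by (auto simp: strip_removals_def interlaces_def)
  have lt_k: "x < k" if "i < L" "x \<in> set (T ! i)" for i x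
    using tableaux_entries[OF T that(1)] that(2) assms(2) by auto
  have nth: "extend L k \<kappa> T ! i = T ! i @ replicate (\<kappa> i - \<rho> i) k" if "i < L" for i
    using that row(1) by (simp add: extend_def)
  have len': "length (extend L k \<kappa> T) = L" by (simp add: extend_def)
  show "truncate k (extend L k \<kappa> T) = T"
    using len len' lt_k
    by (intro nth_equalityI) (auto simp: truncate_def nth filter_id_conv filter_empty_conv)
  show "shape_of T = \<rho>"
    using len row(1) strip_removals_supported[OF assms(3,1)] by (auto simp: shape_of_def supported_def)
  have "sorted (extend L k \<kappa> T ! i)" "length (extend L k \<kappa> T ! i) = \<kappa> i" if "i < L" for i
    using nth[OF that] row[OF that] le(1)[of i] lt_k[OF that] by (auto simp: sorted_append less_imp_le)
  moreover have "extend L k \<kappa> T ! i ! j < extend L k \<kappa> T ! Suc i ! j" if "Suc i < L" "j < \<kappa> (Suc i)" for i j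
  proof -
    have "j < \<rho> i" using that le(2)[of i] by simp
    then have "extend L k \<kappa> T ! i ! j = T ! i ! j" "T ! i ! j < k"
      using that row(1)[of i] nth[of i] lt_k[of i "T ! i ! j"] by (auto simp: nth_append)
    moreover have "extend L k \<kappa> T ! Suc i ! j = (if j < \<rho> (Suc i) then T ! Suc i ! j else k)"
      using that nth[of "Suc i"] row(1)[of "Suc i"] by (simp add: nth_append)
    ultimately show ?thesis using col[of i j] that by simp
  qed
  moreover have "(\<Sum>i<L. count_list (extend L k \<kappa> T ! i) v) = Poly_Mapping.lookup (m + Poly_Mapping.single k a) v" for v
  proof -
    have "count_list (replicate n k) v = (if v = k then n else 0)" for n by (induction n) auto
    then have "(\<Sum>i<L. count_list (extend L k \<kappa> T ! i) v)
        = (\<Sum>i<L. count_list (T ! i) v + (if v = k then \<kappa> i - \<rho> i else 0))"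
      using nth by (intro sum.cong) auto
    also have "\<dots> = Poly_Mapping.lookup m v + (if v = k then \<Sum>i<L. \<kappa> i - \<rho> i else 0)"
      using content[of v] by (simp add: sum.distrib)
    also have "(\<Sum>i<L. \<kappa> i - \<rho> i) = a"
      using assms(3) le(1) sum_subtractf_nat[of "{..<L}" \<rho> \<kappa>] by (auto simp: strip_removals_def)
    finally show ?thesis by (simp add: lookup_add lookup_single)
  qed
  ultimately show "extend L k \<kappa> T \<in> tableaux L \<kappa> (m + Poly_Mapping.single k a)"
    using len' by (simp add: tableaux_iff)
qed

lemma card_tableaux_step:
  assumes "antimono \<kappa>" "supported L \<kappa>" "Poly_Mapping.keys m \<subseteq> {..<k}"
  shows "card (tableaux L \<kappa> (m + Poly_Mapping.single k a))
    = (\<Sum>\<rho>\<in>strip_removals L \<kappa> a. card (tableaux L \<rho> m))"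
proof -
  have "bij_betw (\<lambda>T. (shape_of (truncate k T), truncate k T))
     (tableaux L \<kappa> (m + Poly_Mapping.single k a))
     (Sigma (strip_removals L \<kappa> a) (\<lambda>\<rho>. tableaux L \<rho> m))"
    by (rule bij_betw_byWitness[where f' = "\<lambda>(\<rho>, T). extend L k \<kappa> T"])
      (use truncate_tableau[OF assms] extend_tableau[OF assms(2,3)] in auto)
  then show ?thesis
    using card_SigmaI[OF finite_strip_removals[OF assms(2)], of a "\<lambda>\<rho>. tableaux L \<rho> m"] finite_tableaux
    by (simp add: bij_betw_same_card)
qed

text \<open>
  Peeling off the largest variable of the monomial is the recursion that defines \<open>kostka\<close>, which is why
  the weights appear reversed there.
\<close>
lemma card_tableaux:
  assumes "antimono \<kappa>" "supported L \<kappa>" "length is = length \<gamma>" "sorted_wrt (<) is"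
  shows "card (tableaux L \<kappa> (sum_list (map2 Poly_Mapping.single is \<gamma>))) = kostka L \<kappa> (rev \<gamma>)"
  using assms
proof (induction \<gamma> arbitrary: "is" \<kappa> rule: rev_induct)
  case Nil
  have "tableaux L \<kappa> 0 = (if \<kappa> = (\<lambda>_. 0) then {replicate L []} else {})"
  proof -
    have "T \<in> tableaux L \<kappa> 0 \<longleftrightarrow> \<kappa> = (\<lambda>_. 0) \<and> T = replicate L []" for T
    proof
      assume T: "T \<in> tableaux L \<kappa> 0"
      then have rows: "T ! i = []" "\<kappa> i = 0" if "i < L" for i
        using tableaux_entries[OF T that] that by (auto simp: tableaux_iff)
      have "\<kappa> i = 0" for i
        using rows(2)[of i] Nil.prems(2) by (cases "i < L") (auto simp: supported_def)
      moreover have "T = replicate L []"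
        using T rows(1) by (intro nth_equalityI) (auto simp: tableaux_iff)
      ultimately show "\<kappa> = (\<lambda>_. 0) \<and> T = replicate L []" by blast
    next
      assume "\<kappa> = (\<lambda>_. 0) \<and> T = replicate L []"
      then show "T \<in> tableaux L \<kappa> 0" by (simp add: tableaux_iff)
    qed
    then show ?thesis by auto
  qed
  then show ?case using Nil by simp
next
  case (snoc a \<gamma>)
  then obtain is' k where "is": "is = is' @ [k]" by (cases "is" rule: rev_cases) auto
  let ?m = "sum_list (map2 Poly_Mapping.single is' \<gamma>)"
  have lens: "length is' = length \<gamma>" and sorted: "sorted_wrt (<) is'" "\<forall>i\<in>set is'. i < k"
    using snoc.prems "is" by (auto simp: sorted_wrt_append)
  have "Poly_Mapping.keys ?m \<subseteq> {..<k}"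
    using lookup_product_notin[OF lens] sorted(2) by (auto simp: in_keys_iff)
  then have "card (tableaux L \<kappa> (?m + Poly_Mapping.single k a))
      = (\<Sum>\<rho>\<in>strip_removals L \<kappa> a. card (tableaux L \<rho> ?m))"
    using snoc.prems by (intro card_tableaux_step)
  also have "\<dots> = (\<Sum>\<rho>\<in>strip_removals L \<kappa> a. kostka L \<rho> (rev \<gamma>))"
    using lens sorted(1) snoc.prems(2)
    by (intro sum.cong snoc.IH) (auto simp: strip_removals_def intro: interlaces_antimono interlaces_supported)
  finally show ?case using "is" lens by simp
qed

section \<open>F-positivity and symmetry of Schur functions\<close>

definition row_length :: "nat list \<Rightarrow> nat \<Rightarrow> nat" where
  "row_length \<nu> i = (if i < length \<nu> then \<nu> ! i else 0)"

lemma supported_row: "supported (length \<nu>) (row_length \<nu>)"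
  by (simp add: supported_def row_length_def)

lemma antimono_row: "partition \<nu> \<Longrightarrow> antimono (row_length \<nu>)"
  by (auto simp: antimono_def row_length_def partition_def sorted_wrt_iff_nth_less) (metis le_less)

lemma map_row: "map (row_length \<nu>) [0..<length \<nu>] = \<nu>"
  by (rule nth_equalityI) (auto simp: row_length_def)

lemma sum_row: "sum (row_length \<nu>) {..<length \<nu>} = sum_list \<nu>"
  by (simp add: row_length_def sum_list_sum_nth atLeast0LessThan)

lemma row_length_inject:
  assumes "composition \<nu>" "composition \<kappa>" "row_length \<nu> = row_length \<kappa>"
  shows "\<nu> = \<kappa>"
proof -
  have *: "i < length \<nu> \<longleftrightarrow> row_length \<nu> i \<noteq> 0" if "composition \<nu>" for \<nu> i
    using that nth_mem[of i \<nu>] by (force simp: row_length_def composition_def)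
  have "i < length \<nu> \<longleftrightarrow> i < length \<kappa>" for i
    using *[OF assms(1)] *[OF assms(2)] assms(3) by simp
  from this[of "length \<nu>"] this[of "length \<kappa>"] have "length \<nu> = length \<kappa>" by simp
  then show ?thesis using assms(3) by (metis map_row)
qed

lemma schur_eq_kostka:
  assumes "partition \<nu>"
  shows "schur \<nu> m = of_nat (kostka (length \<nu>) (row_length \<nu>) (rev (weights m)))"
proof -
  have "{T. ssyt \<nu> T \<and> tableau_monomial T = m} = tableaux (length \<nu>) (row_length \<nu>) m"
    by (simp add: tableaux_def map_row)
  moreover have "card (tableaux (length \<nu>) (row_length \<nu>) m) = kostka (length \<nu>) (row_length \<nu>) (rev (weights m))"
    using card_tableaux[OF antimono_row[OF assms] supported_row,
        of "sorted_list_of_set (Poly_Mapping.keys m)" "weights m"]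
    by (simp add: sum_over_keys) (simp add: weights_def)
  ultimately show ?thesis by (simp add: schur_def)
qed

text \<open>
  The number of standard tableaux of shape \<open>\<nu>\<close> with descent composition \<open>\<alpha>\<close>, in terms of lattice words.
\<close>
definition schur_coeff :: "nat list \<Rightarrow> nat list \<Rightarrow> nat" where
  "schur_coeff \<nu> \<alpha> = card {w \<in> lattice_words (row_length \<nu>). rev (runs w) = \<alpha>}"

lemma length_lattice_word:
  assumes "w \<in> lattice_words (row_length \<nu>)"
  shows "length w = sum_list \<nu>"
proof -
  have "count_list w = row_length \<nu>" using assms by (simp add: lattice_words_def)
  then show ?thesis
    using length_eq_sum_counts[of "length \<nu>" w] sum_row[of \<nu>] supported_row[of \<nu>] by simp
qed

lemma schur_coeff_nonzero:
  assumes "schur_coeff \<nu> \<alpha> \<noteq> 0"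
  shows "composition \<alpha>" "sum_list \<alpha> = sum_list \<nu>"
proof -
  have "{w \<in> lattice_words (row_length \<nu>). rev (runs w) = \<alpha>} \<noteq> {}"
    using assms by (metis card.empty schur_coeff_def)
  then obtain w where w: "w \<in> lattice_words (row_length \<nu>)" "\<alpha> = rev (runs w)" by blast
  then show "composition \<alpha>" "sum_list \<alpha> = sum_list \<nu>"
    using composition_runs[of w] sum_list_runs[of w] length_lattice_word[OF w(1)]
    by (simp_all add: composition_def)
qed

text \<open>
  The lattice words that fit the exponents of \<open>m\<close> are grouped by their runs. The index set is any
  sufficiently large finite set, so that expansions of different functions can be compared over a
  common one.
\<close>
lemma schur_expansion:
  assumes "partition \<nu>" "finite A" "{\<alpha>. composition \<alpha> \<and> sum_list \<alpha> = sum_list \<nu>} \<subseteq> A"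
  shows "schur \<nu> m = (\<Sum>\<alpha>\<in>A. of_nat (schur_coeff \<nu> \<alpha>) * fundamental_qsym \<alpha> m)"
proof -
  let ?W = "lattice_words (row_length \<nu>)" and ?g = "\<lambda>w. rev (runs w)"
  have fin: "finite ?W" using supported_row by (rule finite_lattice_words)
  have "fits (rev (weights m)) w \<longleftrightarrow> refines (weights m) (?g w)" for w
  proof -
    have "composition (rev (weights m))" using composition_weights by (simp add: composition_def)
    then show ?thesis by (simp add: fits_iff_refines refines_rev_iff)
  qed
  then have "schur \<nu> m = of_nat (card {w \<in> ?W. refines (weights m) (?g w)})"
    using schur_eq_kostka[OF assms(1)] kostka_eq_card_words[OF supported_row] by simp
  also have "\<dots> = (\<Sum>w\<in>?W. of_bool (refines (weights m) (?g w)))"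
    using fin by (simp add: sum_of_bool_eq Collect_conj_eq)
  also have "\<dots> = (\<Sum>\<alpha>\<in>A. \<Sum>w | w \<in> ?W \<and> ?g w = \<alpha>. of_bool (refines (weights m) (?g w)))"
  proof (rule sum.group[symmetric, OF fin assms(2)])
    show "?g ` ?W \<subseteq> A"
      using assms(3) composition_runs sum_list_runs length_lattice_word by (auto simp: composition_def)
  qed
  also have "\<dots> = (\<Sum>\<alpha>\<in>A. of_nat (schur_coeff \<nu> \<alpha>) * fundamental_qsym \<alpha> m)"
    by (intro sum.cong) (auto simp: schur_coeff_def fundamental_qsym_apply)
  finally show ?thesis .
qed

text \<open>
  A shortest composition \<open>\<beta>\<close> at which the coefficients differ gives a contradiction at the monomial with
  exponents \<open>\<beta>\<close>: there only compositions coarser than \<open>\<beta>\<close> contribute, and they are strictly shorter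
  unless equal to \<open>\<beta>\<close>.
\<close>
lemma fundamental_coefficients_unique:
  assumes "finite A" "\<forall>\<alpha>\<in>A. composition \<alpha>"
    and eq: "\<And>m. (\<Sum>\<alpha>\<in>A. c \<alpha> * fundamental_qsym \<alpha> m) = (\<Sum>\<alpha>\<in>A. d \<alpha> * fundamental_qsym \<alpha> m)"
    and "\<alpha> \<in> A"
  shows "c \<alpha> = d \<alpha>"
proof (rule ccontr)
  define e where "e \<alpha> = c \<alpha> - d \<alpha>" for \<alpha>
  define S where "S = {\<alpha>\<in>A. e \<alpha> \<noteq> 0}"
  assume "c \<alpha> \<noteq> d \<alpha>"
  then have "S \<noteq> {}" using assms(4) by (auto simp: S_def e_def)
  moreover have fin: "finite S" using assms(1) by (simp add: S_def)
  ultimately obtain \<beta> where \<beta>: "\<beta> \<in> S" "\<And>\<gamma>. \<gamma> \<in> S \<Longrightarrow> length \<beta> \<le> length \<gamma>"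
    using arg_min_if_finite[of S length] by (meson not_le)
  \<comment> \<open>Only \<open>\<beta>\<close> itself survives at the monomial with exponents \<open>\<beta>\<close>.\<close>
  have "0 = (\<Sum>\<alpha>\<in>A. e \<alpha> * fundamental_qsym \<alpha> (dominant_monomial \<beta>))"
    using eq by (simp add: e_def left_diff_distrib sum_subtractf)
  also have "\<dots> = (\<Sum>\<alpha>\<in>{\<beta>}. e \<alpha> * fundamental_qsym \<alpha> (dominant_monomial \<beta>))"
  proof (rule sum.mono_neutral_right)
    show "finite A" "{\<beta>} \<subseteq> A" using assms(1) \<beta>(1) by (auto simp: S_def)
    show "\<forall>\<alpha>\<in>A - {\<beta>}. e \<alpha> * fundamental_qsym \<alpha> (dominant_monomial \<beta>) = 0"
    proof
      fix \<alpha> assume \<alpha>: "\<alpha> \<in> A - {\<beta>}"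
      show "e \<alpha> * fundamental_qsym \<alpha> (dominant_monomial \<beta>) = 0"
      proof (cases "e \<alpha> = 0")
        case False
        then have "length \<beta> \<le> length \<alpha>" using \<alpha> \<beta>(2) by (simp add: S_def)
        moreover have "composition \<beta>" using assms(2) \<beta>(1) by (auto simp: S_def)
        ultimately show ?thesis
          using \<alpha> refines_composition(4,5)[of \<beta> \<alpha>] by (auto simp: fundamental_qsym_apply)
      qed simp
    qed
  qed
  also have "\<dots> = e \<beta>"
    using assms(2) \<beta>(1) by (auto simp: fundamental_qsym_apply refines_refl S_def)
  finally show False using \<beta>(1) by (simp add: S_def)
qed

lemma mset_weights: "mset (weights m) = image_mset (Poly_Mapping.lookup m) (mset_set (Poly_Mapping.keys m))"
  using mset_set_set[of "sorted_list_of_set (Poly_Mapping.keys m)"] by (simp add: weights_def)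

lemma mset_weights_map_key:
  assumes "bij \<pi>"
  shows "mset (weights (Poly_Mapping.map_key \<pi> m)) = mset (weights m)"
proof -
  have inj: "inj \<pi>" using assms by (rule bij_is_inj)
  let ?K = "\<pi> -` Poly_Mapping.keys m"
  have "mset (weights (Poly_Mapping.map_key \<pi> m))
      = image_mset (Poly_Mapping.lookup m) (image_mset \<pi> (mset_set ?K))"
    unfolding mset_weights keys_map_key[OF inj] map_key.rep_eq[OF inj] multiset.map_comp ..
  also have "image_mset \<pi> (mset_set ?K) = mset_set (\<pi> ` ?K)"
    using inj by (intro image_mset_mset_set) (simp add: inj_on_def)
  also have "\<pi> ` ?K = Poly_Mapping.keys m" using assms by (simp add: bij_is_surj surj_image_vimage_eq)
  finally show ?thesis by (simp add: mset_weights)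
qed

lemma schur_nonzero_degree:
  assumes "partition \<nu>" "schur \<nu> m \<noteq> 0"
  shows "total_degree m = sum_list \<nu>"
proof -
  have "(\<Sum>\<alpha> | composition \<alpha> \<and> sum_list \<alpha> = sum_list \<nu>. of_nat (schur_coeff \<nu> \<alpha>) * fundamental_qsym \<alpha> m) \<noteq> 0"
    using assms schur_expansion[OF assms(1) finite_compositions order_refl] by simp
  then obtain \<alpha> where "sum_list \<alpha> = sum_list \<nu>" "fundamental_qsym \<alpha> m \<noteq> 0"
    by (auto elim!: sum.not_neutral_contains_not_neutral)
  then show ?thesis
    using refines_composition(3)[of "weights m" \<alpha>] by (simp add: fundamental_qsym_apply sum_list_weights split: if_splits)
qed

lemma schur_symmetric:
  assumes "partition \<nu>"
  shows "schur \<nu> \<in> Sym"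
proof -
  have "schur \<nu> (Poly_Mapping.map_key \<pi> m) = schur \<nu> m" if "bij \<pi>" for \<pi> m
    unfolding schur_eq_kostka[OF assms]
    using kostka_mset[OF supported_row, of "rev (weights (Poly_Mapping.map_key \<pi> m))" "rev (weights m)"]
      mset_weights_map_key[OF that] by simp
  then show ?thesis
    unfolding Sym_def using schur_nonzero_degree[OF assms] by fastforce
qed

lemma schur_in_cone:
  assumes "partition \<nu>"
  shows "schur \<nu> \<in> F_positive_cone"
proof -
  let ?c = "\<lambda>\<alpha>. of_nat (schur_coeff \<nu> \<alpha>) :: rat"
  let ?C = "{\<alpha>. composition \<alpha> \<and> sum_list \<alpha> = sum_list \<nu>}"
  have sub: "{\<alpha>. ?c \<alpha> \<noteq> 0} \<subseteq> ?C" using schur_coeff_nonzero by auto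
  have "schur \<nu> m = (\<Sum>\<alpha> | ?c \<alpha> \<noteq> 0. scale (?c \<alpha>) (fundamental_qsym \<alpha>)) m" for m
  proof -
    have "schur \<nu> m = (\<Sum>\<alpha>\<in>?C. ?c \<alpha> * fundamental_qsym \<alpha> m)"
      by (rule schur_expansion[OF assms finite_compositions order_refl])
    also have "\<dots> = (\<Sum>\<alpha> | ?c \<alpha> \<noteq> 0. ?c \<alpha> * fundamental_qsym \<alpha> m)"
      using sub by (intro sum.mono_neutral_right finite_compositions) auto
    finally show ?thesis by (simp add: sum_apply scale_def)
  qed
  moreover have "finite {\<alpha>. ?c \<alpha> \<noteq> 0}" using sub finite_compositions by (rule finite_subset)
  ultimately show ?thesis
    unfolding F_positive_cone_def using schur_symmetric[OF assms] sub
    by (intro CollectI conjI exI[of _ ?c]) auto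
qed

text \<open>
  Inside an initial segment that contains the given values and arguments, the complements have equal
  size and can be matched. Everything beyond is fixed.
\<close>
lemma ex_bij_extending:
  assumes "distinct (ks :: nat list)"
  shows "\<exists>\<pi> :: nat \<Rightarrow> nat. bij \<pi> \<and> (\<forall>i<length ks. \<pi> i = ks ! i)"
proof -
  define n where "n = length ks"
  obtain N where N: "set ks \<union> {..<n} \<subseteq> {..<N}"
    using finite_nat_set_iff_bounded[of "set ks \<union> {..<n}"]
    by (metis List.finite_set finite_Un finite_lessThan lessThan_iff subsetI)
  have "card ({..<N} - {..<n}) = card ({..<N} - set ks)"
    using N assms by (simp add: card_Diff_subset distinct_card n_def)
  then obtain g where g: "bij_betw g ({..<N} - {..<n}) ({..<N} - set ks)"
    using finite_same_card_bij by (metis finite_Diff finite_lessThan)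
  have f: "bij_betw ((!) ks) {..<n} (set ks)"
    using assms by (intro bij_betw_nth) (auto simp: n_def)
  have "bij_betw (\<lambda>i. if i \<in> {..<n} then ks ! i else g i) ({..<n} \<union> ({..<N} - {..<n})) (set ks \<union> ({..<N} - set ks))"
    using f g by (intro bij_betw_disjoint_Un) auto
  moreover have "{..<n} \<union> ({..<N} - {..<n}) = {..<N}" "set ks \<union> ({..<N} - set ks) = {..<N}"
    using N by auto
  ultimately have "bij_betw (\<lambda>i. if i \<in> {..<n} then ks ! i else g i) {..<N} {..<N}" by simp
  then have "bij_betw (\<lambda>i. if i \<in> {..<N} then if i \<in> {..<n} then ks ! i else g i else id i) ({..<N} \<union> - {..<N}) ({..<N} \<union> - {..<N})"
    using bij_betw_id[of "- {..<N}"] by (rule bij_betw_disjoint_Un) auto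
  then have "bij (\<lambda>i. if i \<in> {..<N} then if i \<in> {..<n} then ks ! i else g i else id i)"
    unfolding Compl_partition .
  then show ?thesis
    using N by (intro exI[of _ "\<lambda>i. if i \<in> {..<N} then if i \<in> {..<n} then ks ! i else g i else id i"])
      (auto simp: n_def)
qed

lemma lookup_dominant_monomial: "Poly_Mapping.lookup (dominant_monomial \<gamma>) i = row_length \<gamma> i"
proof (cases "i < length \<gamma>")
  case True
  have "map (Poly_Mapping.lookup (dominant_monomial \<gamma>)) [0..<length \<gamma>] = \<gamma>"
    unfolding dominant_monomial_def by (rule lookup_product) auto
  from arg_cong[OF this, of "\<lambda>xs. xs ! i"] show ?thesis using True by (simp add: row_length_def)
next
  case False
  then show ?thesis unfolding dominant_monomial_def
    by (subst lookup_product_notin) (auto simp: row_length_def)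
qed

text \<open>
  Permutations of the variables act by bijections of all natural numbers, so the sorting of the
  finitely many variables of \<open>m\<close> has to be extended.
\<close>
lemma ex_bij_to_dominant:
  "\<exists>\<pi> \<nu>. bij \<pi> \<and> partition \<nu> \<and> Poly_Mapping.map_key \<pi> m = dominant_monomial \<nu> \<and> sum_list \<nu> = total_degree m"
proof -
  define ks where "ks = rev (sort_key (Poly_Mapping.lookup m) (sorted_list_of_set (Poly_Mapping.keys m)))"
  define \<nu> where "\<nu> = map (Poly_Mapping.lookup m) ks"
  have ks: "distinct ks" "set ks = Poly_Mapping.keys m" by (auto simp: ks_def)
  have "sorted_wrt (\<ge>) \<nu>"
    by (simp add: \<nu>_def ks_def rev_map[symmetric] sorted_wrt_rev)
  then have part: "partition \<nu>"
    using ks(2) by (auto simp: partition_def composition_def \<nu>_def in_keys_iff)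
  obtain \<pi> :: "nat \<Rightarrow> nat" where \<pi>: "bij \<pi>" "\<forall>i<length ks. \<pi> i = ks ! i"
    using ex_bij_extending[OF ks(1)] by blast
  have inj: "inj \<pi>" using \<pi>(1) by (rule bij_is_inj)
  have "Poly_Mapping.map_key \<pi> m = dominant_monomial \<nu>"
  proof (rule poly_mapping_eqI)
    fix i
    have "\<pi> i \<notin> set ks" if "length ks \<le> i"
    proof
      assume "\<pi> i \<in> set ks"
      then obtain j where "j < length ks" "\<pi> i = \<pi> j" using \<pi>(2) by (metis in_set_conv_nth)
      then show False using injD[OF inj] that by (metis not_le)
    qed
    then have "Poly_Mapping.lookup m (\<pi> i) = row_length \<nu> i"
      using \<pi>(2) ks(2) by (auto simp: row_length_def \<nu>_def in_keys_iff)
    then show "Poly_Mapping.lookup (Poly_Mapping.map_key \<pi> m) i = Poly_Mapping.lookup (dominant_monomial \<nu>) i"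
      by (simp add: map_key.rep_eq[OF inj] lookup_dominant_monomial)
  qed
  moreover have "sum_list \<nu> = total_degree m"
    using ks by (simp add: \<nu>_def total_degree_def sum_list_distinct_conv_sum_set)
  ultimately show ?thesis using \<pi>(1) part by blast
qed

lemma symmetric_eq_0:
  assumes "\<And>\<pi> m. bij \<pi> \<Longrightarrow> f (Poly_Mapping.map_key \<pi> m) = f m"
    and "\<And>\<nu>. partition \<nu> \<Longrightarrow> f (dominant_monomial \<nu>) = 0"
  shows "f m = 0"
  using ex_bij_to_dominant[of m] assms by metis

section \<open>Extremal monomials and extremal descents\<close>

text \<open>
  The number usually written \<open>n(\<nu>)\<close>: the sum over the cells of the diagram of the number of their row.
\<close>
definition row_index_sum :: "nat list \<Rightarrow> nat" where
  "row_index_sum \<nu> = (\<Sum>i<length \<nu>. i * row_length \<nu> i)"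

lemma row_length_snoc: "row_length (\<gamma> @ [a]) i = (if i = length \<gamma> then a else row_length \<gamma> i)"
  by (auto simp: row_length_def nth_append)

lemma row_index_sum_snoc: "row_index_sum (\<gamma> @ [a]) = row_index_sum \<gamma> + length \<gamma> * a"
  by (simp add: row_index_sum_def row_length_snoc)

text \<open>
  A letter \<open>v\<close> occurs only in the rows \<open>0, \<dots>, v\<close>, because a strip reaches at most one row further down.
  So each strip adds at most \<open>length \<gamma> * a\<close> to the sum of row numbers. Equality means that each strip lies
  entirely in the lowest admissible row, and this determines the shape.
\<close>
lemma kostka_nonzero:
  assumes "kostka L \<kappa> (rev \<gamma>) \<noteq> 0" "supported L \<kappa>"
  shows "(\<Sum>i<L. i * \<kappa> i) \<le> row_index_sum \<gamma>"
    "(\<Sum>i<L. i * \<kappa> i) = row_index_sum \<gamma> \<Longrightarrow> \<kappa> = row_length \<gamma>"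
proof -
  have "supported (length \<gamma>) \<kappa> \<and> (\<Sum>i<L. i * \<kappa> i) \<le> row_index_sum \<gamma> \<and>
      ((\<Sum>i<L. i * \<kappa> i) = row_index_sum \<gamma> \<longrightarrow> \<kappa> = row_length \<gamma>)"
    using assms
  proof (induction \<gamma> arbitrary: \<kappa> rule: rev_induct)
    case Nil
    then show ?case by (simp add: supported_def row_index_sum_def row_length_def fun_eq_iff split: if_splits)
  next
    case (snoc a \<gamma>)
    let ?l = "length \<gamma>"
    have "(\<Sum>\<rho>\<in>strip_removals L \<kappa> a. kostka L \<rho> (rev \<gamma>)) \<noteq> 0" using snoc.prems(1) by simp
    then obtain \<rho> where \<rho>: "\<rho> \<in> strip_removals L \<kappa> a" "kostka L \<rho> (rev \<gamma>) \<noteq> 0"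
      by (rule sum.not_neutral_contains_not_neutral)
    have IH: "supported ?l \<rho>" "(\<Sum>i<L. i * \<rho> i) \<le> row_index_sum \<gamma>" "(\<Sum>i<L. i * \<rho> i) = row_index_sum \<gamma> \<Longrightarrow> \<rho> = row_length \<gamma>"
      using snoc.IH[OF \<rho>(2)] strip_removals_supported[OF \<rho>(1) snoc.prems(2)] by auto
    have le: "\<rho> i \<le> \<kappa> i" "\<kappa> (Suc i) \<le> \<rho> i" for i
      using \<rho>(1) by (auto simp: strip_removals_def interlaces_def)
    have a: "(\<Sum>i<L. \<kappa> i - \<rho> i) = a"
      using \<rho>(1) le(1) sum_subtractf_nat[of "{..<L}" \<rho> \<kappa>] by (auto simp: strip_removals_def)
    have supp: "\<kappa> i = 0" if "?l < i" for i
      using that le(2)[of "i - 1"] IH(1) by (cases i) (auto simp: supported_def)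
    have bound: "i * (\<kappa> i - \<rho> i) \<le> ?l * (\<kappa> i - \<rho> i)" for i
      using supp[of i] by (cases "?l < i") auto
    have "i * \<kappa> i = i * \<rho> i + i * (\<kappa> i - \<rho> i)" for i
      using le(1)[of i] by (simp add: diff_mult_distrib2)
    then have split: "(\<Sum>i<L. i * \<kappa> i) = (\<Sum>i<L. i * \<rho> i) + (\<Sum>i<L. i * (\<kappa> i - \<rho> i))"
      by (simp add: sum.distrib)
    have sums: "(\<Sum>i<L. i * (\<kappa> i - \<rho> i)) \<le> (\<Sum>i<L. ?l * (\<kappa> i - \<rho> i))"
      using bound by (intro sum_mono)
    have la: "(\<Sum>i<L. ?l * (\<kappa> i - \<rho> i)) = ?l * a" using a by (simp flip: sum_distrib_left)
    have "\<kappa> = row_length (\<gamma> @ [a])" if "(\<Sum>i<L. i * \<kappa> i) = row_index_sum (\<gamma> @ [a])"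
    proof
      fix i
      have eqs: "\<rho> = row_length \<gamma>" "(\<Sum>i<L. i * (\<kappa> i - \<rho> i)) = (\<Sum>i<L. ?l * (\<kappa> i - \<rho> i))"
        using that split sums la IH(2,3) by (auto simp: row_index_sum_snoc)
      have same: "\<kappa> j = \<rho> j" if "j \<noteq> ?l" for j
      proof (cases "j < L")
        case True
        then have "j * (\<kappa> j - \<rho> j) = ?l * (\<kappa> j - \<rho> j)"
          using sum_mono_inv[OF eqs(2)] bound by auto
        then show ?thesis using that le(1)[of j] by simp
      next
        case False
        then show ?thesis using snoc.prems(2) le(1)[of j] by (simp add: supported_def)
      qed
      have "a = (\<Sum>j<L. if j = ?l then \<kappa> ?l - \<rho> ?l else 0)"
        unfolding a[symmetric] using same by (intro sum.cong) auto
      also have "\<dots> = \<kappa> ?l"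
        using IH(1) snoc.prems(2) by (auto simp: supported_def)
      finally show "\<kappa> i = row_length (\<gamma> @ [a]) i"
        using same eqs(1) by (simp add: row_length_snoc)
    qed
    then show ?case
      using supp split sums la IH(2) by (auto simp: supported_def row_index_sum_snoc)
  qed
  then show "(\<Sum>i<L. i * \<kappa> i) \<le> row_index_sum \<gamma>"
    "(\<Sum>i<L. i * \<kappa> i) = row_index_sum \<gamma> \<Longrightarrow> \<kappa> = row_length \<gamma>" by auto
qed

lemma kostka_self:
  assumes "partition \<gamma>" "length \<gamma> \<le> L"
  shows "kostka L (row_length \<gamma>) (rev \<gamma>) \<noteq> 0"
  using assms
proof (induction \<gamma> rule: rev_induct)
  case Nil
  then show ?case by (simp add: row_length_def)
next
  case (snoc a \<gamma>)
  have part: "partition \<gamma>" "\<And>b. b \<in> set \<gamma> \<Longrightarrow> a \<le> b"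
    using snoc.prems by (auto simp: partition_def composition_def sorted_wrt_append)
  have "row_length (\<gamma> @ [a]) (Suc i) \<le> row_length \<gamma> i" for i
    using antimono_row[OF part(1)] part(2)[of "\<gamma> ! i"] decseq_SucD[of "row_length \<gamma>" i]
    unfolding row_length_snoc by (auto simp: row_length_def[of \<gamma> i])
  moreover have "row_length \<gamma> i \<le> row_length (\<gamma> @ [a]) i" for i by (simp add: row_length_snoc) (simp add: row_length_def)
  moreover have "sum (row_length \<gamma>) {..<L} + a = sum (row_length (\<gamma> @ [a])) {..<L}"
  proof -
    have "row_length (\<gamma> @ [a]) i = row_length \<gamma> i + (if i = length \<gamma> then a else 0)" for i
      by (simp add: row_length_snoc) (simp add: row_length_def)
    then show ?thesis using snoc.prems(2) by (simp add: sum.distrib)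
  qed
  ultimately have mem: "row_length \<gamma> \<in> strip_removals L (row_length (\<gamma> @ [a])) a"
    by (simp add: strip_removals_def interlaces_def)
  have "supported L (row_length (\<gamma> @ [a]))"
    using snoc.prems(2) by (simp add: supported_def row_length_def)
  then have "kostka L (row_length \<gamma>) (rev \<gamma>) \<le> kostka L (row_length (\<gamma> @ [a])) (rev (\<gamma> @ [a]))"
    using mem by (simp, intro member_le_sum) auto
  then show ?case using snoc.IH part snoc.prems(2) by simp
qed

lemma schur_dominant_nonzero:
  assumes "partition \<kappa>" "partition \<nu>" "schur \<kappa> (dominant_monomial \<nu>) \<noteq> 0"
  shows "row_index_sum \<kappa> \<le> row_index_sum \<nu>" "row_index_sum \<kappa> = row_index_sum \<nu> \<Longrightarrow> \<kappa> = \<nu>"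
proof -
  have comp: "composition \<kappa>" "composition \<nu>" using assms(1,2) by (auto simp: partition_def)
  have "kostka (length \<kappa>) (row_length \<kappa>) (rev \<nu>) \<noteq> 0"
    using assms(3) schur_eq_kostka[OF assms(1)] comp by simp
  note * = kostka_nonzero[OF this supported_row]
  show "row_index_sum \<kappa> \<le> row_index_sum \<nu>" "row_index_sum \<kappa> = row_index_sum \<nu> \<Longrightarrow> \<kappa> = \<nu>"
    using * row_length_inject[OF comp] unfolding row_index_sum_def by blast+
qed

lemma schur_dominant_self:
  assumes "partition \<nu>"
  shows "schur \<nu> (dominant_monomial \<nu>) \<noteq> 0"
  using kostka_self[OF assms order_refl] schur_eq_kostka[OF assms] assms by (simp add: partition_def)

text \<open>
  Words of the tableaux that are filled column by column: reading from right to left, each letter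
  either descends by one row or starts a new column in row \<open>0\<close>.
\<close>
fun column_word :: "nat list \<Rightarrow> bool" where
  "column_word [] \<longleftrightarrow> True"
| "column_word [i] \<longleftrightarrow> i = 0"
| "column_word (i # j # w) \<longleftrightarrow> (i = 0 \<or> i = Suc j) \<and> column_word (j # w)"

text \<open>
  Induction on the number of columns. The last column occupies the first \<open>h\<close> rows, those whose length
  is maximal, and is added from top to bottom.
\<close>
lemma ex_column_word:
  assumes "antimono \<kappa>" "supported L \<kappa>" "\<kappa> 0 \<le> c"
  shows "\<exists>u\<in>lattice_words \<kappa>. column_word u"
  using assms
proof (induction c arbitrary: \<kappa>)
  case 0
  then have "\<kappa> = (\<lambda>_. 0)" by (auto simp: antimono_def) (metis le_zero_eq zero_le)
  then show ?case by (intro bexI[of _ "[]"]) (auto simp: lattice_words_def)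
next
  case (Suc c)
  let ?\<kappa> = "\<lambda>i. min (\<kappa> i) c"
  have "antimono ?\<kappa>" "supported L ?\<kappa>" "?\<kappa> 0 \<le> c"
    using Suc.prems(1,2) by (auto simp: antimono_def supported_def min.coboundedI1)
  then obtain u where u: "lattice_word u" "count_list u = ?\<kappa>" "column_word u"
    using Suc.IH[of ?\<kappa>] unfolding lattice_words_def by blast
  define h where "h = (LEAST i. \<kappa> i \<le> c)"
  have "\<kappa> L \<le> c" using Suc.prems(2) by (simp add: supported_def)
  then have h: "\<kappa> h \<le> c" unfolding h_def by (rule LeastI)
  have full: "\<kappa> i = Suc c" if "i < h" for i
  proof -
    have "\<not> \<kappa> i \<le> c" using that not_less_Least unfolding h_def by blast
    moreover have "\<kappa> i \<le> Suc c" using antimonoD[OF Suc.prems(1), of 0 i] Suc.prems(3) by simp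
    ultimately show ?thesis by simp
  qed
  have small: "\<kappa> i \<le> c" if "h \<le> i" for i
    using antimonoD[OF Suc.prems(1) that] h by simp
  have step: "lattice_word (rev [0..<k] @ u) \<and> column_word (rev [0..<k] @ u) \<and>
      (\<forall>i. count_list (rev [0..<k] @ u) i = ?\<kappa> i + of_bool (i < k))" if "k \<le> h" for k
    using that
  proof (induction k)
    case 0
    then show ?case using u by simp
  next
    case (Suc k)
    let ?w = "rev [0..<k] @ u"
    have IH: "lattice_word ?w" "column_word ?w" "\<And>i. count_list ?w i = ?\<kappa> i + of_bool (i < k)"
      using Suc by auto
    have eq: "rev [0..<Suc k] @ u = k # ?w" by simp
    have "lattice_word (k # ?w)"
    proof (cases k)
      case 0
      then show ?thesis using IH(1) by simp
    next
      case (Suc j)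
      have "count_list ?w (Suc j) = c" "count_list ?w j = Suc c"
        unfolding IH(3) using full[of j] full[of "Suc j"] \<open>Suc k \<le> h\<close> Suc by auto
      then show ?thesis using IH(1) Suc by (simp del: count_list_append)
    qed
    moreover have "column_word (k # ?w)"
    proof (cases k)
      case 0
      then show ?thesis using IH(2) by (cases ?w) auto
    next
      case (Suc j)
      then show ?thesis using IH(2) by simp
    qed
    moreover have "count_list (k # ?w) i = ?\<kappa> i + of_bool (i < Suc k)" for i
      using IH(3)[of i] by (auto simp: less_Suc_eq simp del: count_list_append)
    ultimately show ?case unfolding eq by blast
  qed
  let ?w = "rev [0..<h] @ u"
  have "count_list ?w i = \<kappa> i" for i
    using step[of h] full[of i] small[of i] by (cases "i < h") (auto simp del: count_list_append)
  then have "?w \<in> lattice_words \<kappa>" using step[of h] by (auto simp: lattice_words_def simp del: count_list_append)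
  then show ?case using step[of h] by blast
qed

text \<open>
  Runs are nonempty, so the first run has length \<open>1\<close> exactly when there is a descent at the front.
\<close>
lemma runs_Cons_eqD:
  assumes "runs (x # y # w) = runs (x' # y' # w')"
  shows "x \<le> y \<longleftrightarrow> x' \<le> y'" "runs (y # w) = runs (y' # w')"
proof -
  have pos: "\<exists>r rs. runs (y # w) = Suc r # rs" for y w
    using composition_runs[of "y # w"]
    by (cases "runs (y # w)") (auto simp: composition_def gr0_conv_Suc)
  obtain r rs r' rs' where "runs (y # w) = Suc r # rs" "runs (y' # w') = Suc r' # rs'"
    using pos[of y w] pos[of y' w'] by blast
  then show "x \<le> y \<longleftrightarrow> x' \<le> y'" "runs (y # w) = runs (y' # w')"
    using assms by (auto split: if_splits)
qed

text \<open>
  At a descent any word goes down at least one row, a column word exactly one. At all other places a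
  column word returns to row \<open>0\<close>.
\<close>
lemma column_word_minimal:
  assumes "column_word u" "runs u = runs w"
  shows "list_all2 (\<le>) u w"
  using assms
proof (induction u arbitrary: w rule: column_word.induct)
  case 1
  then show ?case by (metis list_all2_Nil runs.simps(1) runs_eq_Nil_iff)
next
  case (2 i)
  then have "length w = 1" using sum_list_runs[of w] sum_list_runs[of "[i]"] by simp
  then show ?case using 2 by (cases w) auto
next
  case (3 i j u)
  have "length w = length (i # j # u)" using sum_list_runs[of w] sum_list_runs[of "i # j # u"] 3 by simp
  then obtain i' j' w' where w: "w = i' # j' # w'" by (auto simp: length_Suc_conv)
  note eq = runs_Cons_eqD[OF "3.prems"(2)[unfolded w]]
  have IH: "list_all2 (\<le>) (j # u) (j' # w')"
    using "3.prems"(1) eq(2) by (intro "3.IH") simp_all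
  have "i \<le> i'"
  proof (cases "i \<le> j")
    case True
    then show ?thesis using "3.prems"(1) by auto
  next
    case False
    then show ?thesis using "3.prems"(1) eq(1) IH by auto
  qed
  then show ?case using IH w by simp
qed

lemma sum_list_lattice_word:
  assumes "w \<in> lattice_words (row_length \<nu>)"
  shows "sum_list w = row_index_sum \<nu>"
proof -
  have w: "count_list w = row_length \<nu>" using assms by (simp add: lattice_words_def)
  have "set w \<subseteq> {..<length \<nu>}"
  proof
    fix i assume "i \<in> set w"
    then have "row_length \<nu> i \<noteq> 0" unfolding w[symmetric] by (simp add: count_list_0_iff)
    then show "i \<in> {..<length \<nu>}" by (simp add: row_length_def split: if_splits)
  qed
  then have "(\<Sum>i<length \<nu>. i * row_length \<nu> i) = (\<Sum>i\<in>set w. i * count_list w i)"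
    unfolding w[symmetric] by (intro sum.mono_neutral_right) auto
  then show ?thesis
    using sum_list_map_eq_sum_count[of "\<lambda>x. x" w] by (simp add: row_index_sum_def mult.commute)
qed

text \<open>
  The sum of the letters of a lattice word is \<open>row_index_sum\<close> of its shape. By
  \<open>column_word_minimal\<close> the column word of \<open>\<nu>\<close> has the least sum among all words with its descents, and
  equality of sums makes the words equal.
\<close>
lemma ex_extremal_descents:
  assumes "partition \<nu>"
  shows "\<exists>\<alpha>. schur_coeff \<nu> \<alpha> \<noteq> 0 \<and>
    (\<forall>\<kappa>. partition \<kappa> \<and> schur_coeff \<kappa> \<alpha> \<noteq> 0 \<longrightarrow> row_index_sum \<nu> \<le> row_index_sum \<kappa> \<and> (row_index_sum \<nu> = row_index_sum \<kappa> \<longrightarrow> \<nu> = \<kappa>))"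
proof -
  obtain u where u: "u \<in> lattice_words (row_length \<nu>)" "column_word u"
    using ex_column_word[OF antimono_row[OF assms] supported_row order_refl] by blast
  have "schur_coeff \<nu> (rev (runs u)) \<noteq> 0"
    using u(1) finite_lattice_words[OF supported_row] by (auto simp: schur_coeff_def)
  moreover have "row_index_sum \<nu> \<le> row_index_sum \<kappa> \<and> (row_index_sum \<nu> = row_index_sum \<kappa> \<longrightarrow> \<nu> = \<kappa>)"
    if \<kappa>: "partition \<kappa>" "schur_coeff \<kappa> (rev (runs u)) \<noteq> 0" for \<kappa>
  proof -
    have "{w \<in> lattice_words (row_length \<kappa>). rev (runs w) = rev (runs u)} \<noteq> {}"
      using \<kappa>(2) unfolding schur_coeff_def by (metis card.empty)
    then obtain w where w: "w \<in> lattice_words (row_length \<kappa>)" "runs w = runs u" by auto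
    have le: "list_all2 (\<le>) u w" using column_word_minimal[OF u(2)] w(2) by simp
    have "sum_list u \<le> sum_list w \<and> (sum_list u = sum_list w \<longrightarrow> u = w)"
      using le by induction auto
    moreover have "\<nu> = \<kappa>" if "u = w"
      using that u(1) w(1) assms \<kappa>(1) row_length_inject by (auto simp: lattice_words_def partition_def)
    ultimately show ?thesis using sum_list_lattice_word[OF u(1)] sum_list_lattice_word[OF w(1)] by auto
  qed
  ultimately show ?thesis by blast
qed

section \<open>Schur expansions and extremality\<close>

abbreviation partitions_of :: "nat \<Rightarrow> nat list set" where
  "partitions_of n \<equiv> {\<nu>. partition \<nu> \<and> sum_list \<nu> = n}"

lemma finite_partitions_of: "finite (partitions_of n)"
  by (rule finite_subset[OF _ finite_compositions[of n]]) (auto simp: partition_def)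

text \<open>
  Triangular elimination in the order of increasing \<open>row_index_sum\<close>. Adding multiples of \<open>s\<^sub>\<nu>\<close> with
  \<open>row_index_sum \<nu> = k\<close> does not disturb the monomials treated before, and among the monomials of level
  \<open>k\<close> it affects only that of \<open>\<nu>\<close> itself.
\<close>
lemma symmetric_schur_combination:
  assumes "f \<in> Sym" and hom: "\<And>m. f m \<noteq> 0 \<Longrightarrow> total_degree m = n"
  obtains a where "\<And>m. f m = (\<Sum>\<nu>\<in>partitions_of n. a \<nu> * schur \<nu> m)"
proof -
  let ?P = "partitions_of n"
  let ?s = "\<lambda>a m. \<Sum>\<nu>\<in>?P. a \<nu> * schur \<nu> m"
  have partial: "\<exists>a. \<forall>\<kappa>\<in>?P. row_index_sum \<kappa> < k \<longrightarrow> f (dominant_monomial \<kappa>) = ?s a (dominant_monomial \<kappa>)" for k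
  proof (induction k)
    case (Suc k)
    then obtain a where a: "\<And>\<kappa>. \<kappa> \<in> ?P \<Longrightarrow> row_index_sum \<kappa> < k \<Longrightarrow> f (dominant_monomial \<kappa>) = ?s a (dominant_monomial \<kappa>)"
      by blast
    \<comment> \<open>Corrects the error that remains at level \<open>k\<close>.\<close>
    define b where "b \<nu> = (if row_index_sum \<nu> = k then (f (dominant_monomial \<nu>) - ?s a (dominant_monomial \<nu>)) / schur \<nu> (dominant_monomial \<nu>) else 0)" for \<nu>
    have s_add: "?s (\<lambda>\<nu>. a \<nu> + b \<nu>) m = ?s a m + ?s b m" for m
      by (simp add: distrib_right sum.distrib)
    have "f (dominant_monomial \<kappa>) = ?s (\<lambda>\<nu>. a \<nu> + b \<nu>) (dominant_monomial \<kappa>)"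
      if \<kappa>: "\<kappa> \<in> ?P" "row_index_sum \<kappa> < Suc k" for \<kappa>
    proof -
      have zero: "b \<nu> * schur \<nu> (dominant_monomial \<kappa>) = 0" if "\<nu> \<in> ?P" "\<nu> \<noteq> \<kappa>" for \<nu>
      proof (cases "row_index_sum \<nu> = k")
        case True
        then have "schur \<nu> (dominant_monomial \<kappa>) = 0"
          using schur_dominant_nonzero[of \<nu> \<kappa>] that \<kappa> by fastforce
        then show ?thesis by simp
      qed (simp add: b_def)
      have "?s b (dominant_monomial \<kappa>) = (\<Sum>\<nu>\<in>{\<kappa>}. b \<nu> * schur \<nu> (dominant_monomial \<kappa>))"
        using \<kappa>(1) zero by (intro sum.mono_neutral_right finite_partitions_of) auto
      then have sb: "?s b (dominant_monomial \<kappa>) = b \<kappa> * schur \<kappa> (dominant_monomial \<kappa>)" by simp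
      show ?thesis
      proof (cases "row_index_sum \<kappa> = k")
        case True
        then show ?thesis unfolding s_add sb using schur_dominant_self[of \<kappa>] \<kappa>(1) by (simp add: b_def)
      next
        case False
        then show ?thesis unfolding s_add sb using a[of \<kappa>] \<kappa> by (simp add: b_def)
      qed
    qed
    then have "\<forall>\<kappa>\<in>?P. row_index_sum \<kappa> < Suc k \<longrightarrow> f (dominant_monomial \<kappa>) = ?s (\<lambda>\<nu>. a \<nu> + b \<nu>) (dominant_monomial \<kappa>)"
      by (intro ballI impI)
    then show ?case by (rule exI[where x = "\<lambda>\<nu>. a \<nu> + b \<nu>"])
  qed simp
  obtain k where "\<forall>x\<in>row_index_sum ` ?P. x < k"
    using finite_partitions_of finite_nat_set_iff_bounded by blast
  then obtain a where a: "\<And>\<kappa>. \<kappa> \<in> ?P \<Longrightarrow> f (dominant_monomial \<kappa>) = ?s a (dominant_monomial \<kappa>)"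
    using partial[of k] by blast
  have "f m - ?s a m = 0" for m
  proof (rule symmetric_eq_0)
    fix \<pi> :: "nat \<Rightarrow> nat" and m assume "bij \<pi>"
    then have invariant: "g (Poly_Mapping.map_key \<pi> m) = g m" if "g \<in> Sym" for g
      using that by (simp add: Sym_def)
    have "?s a (Poly_Mapping.map_key \<pi> m) = ?s a m"
      using invariant[OF schur_symmetric] by (intro sum.cong) auto
    then show "f (Poly_Mapping.map_key \<pi> m) - ?s a (Poly_Mapping.map_key \<pi> m) = f m - ?s a m"
      using invariant[OF assms(1)] by simp
  next
    fix \<kappa> assume \<kappa>: "partition \<kappa>"
    show "f (dominant_monomial \<kappa>) - ?s a (dominant_monomial \<kappa>) = 0"
    proof (cases "sum_list \<kappa> = n")
      case True
      then show ?thesis using a \<kappa> by simp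
    next
      case False
      then have "total_degree (dominant_monomial \<kappa>) \<noteq> n"
        using \<kappa> sum_list_weights[of "dominant_monomial \<kappa>"] by (simp add: partition_def)
      then have "f (dominant_monomial \<kappa>) = 0" "\<And>\<nu>. \<nu> \<in> ?P \<Longrightarrow> schur \<nu> (dominant_monomial \<kappa>) = 0"
        using hom schur_nonzero_degree by blast+
      then show ?thesis by simp
    qed
  qed
  then show ?thesis using that by simp
qed

lemma cone_expansion:
  assumes "f \<in> F_positive_cone"
  obtains c A where "finite A" "\<forall>\<alpha>\<in>A. composition \<alpha>" "\<And>\<alpha>. 0 \<le> c \<alpha>" "\<And>\<alpha>. \<alpha> \<notin> A \<Longrightarrow> c \<alpha> = 0"
    "\<And>B m. finite B \<Longrightarrow> A \<subseteq> B \<Longrightarrow> f m = (\<Sum>\<alpha>\<in>B. c \<alpha> * fundamental_qsym \<alpha> m)"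
proof -
  obtain c where c: "\<forall>\<alpha>. 0 \<le> c \<alpha>" "\<forall>\<alpha>. c \<alpha> \<noteq> 0 \<longrightarrow> composition \<alpha>" "finite {\<alpha>. c \<alpha> \<noteq> 0}"
    "f = (\<Sum>\<alpha> | c \<alpha> \<noteq> 0. scale (c \<alpha>) (fundamental_qsym \<alpha>))"
    using assms by (auto simp: F_positive_cone_def)
  have "f m = (\<Sum>\<alpha>\<in>B. c \<alpha> * fundamental_qsym \<alpha> m)" if "finite B" "{\<alpha>. c \<alpha> \<noteq> 0} \<subseteq> B" for B m
  proof -
    have "f m = (\<Sum>\<alpha> | c \<alpha> \<noteq> 0. c \<alpha> * fundamental_qsym \<alpha> m)"
      by (subst c(4)) (simp add: sum_apply scale_def)
    also have "\<dots> = (\<Sum>\<alpha>\<in>B. c \<alpha> * fundamental_qsym \<alpha> m)"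
      using that by (intro sum.mono_neutral_left) auto
    finally show ?thesis .
  qed
  then show ?thesis using that[of "{\<alpha>. c \<alpha> \<noteq> 0}" c] c by blast
qed

lemma cone_nonneg:
  assumes "f \<in> F_positive_cone"
  shows "0 \<le> f m"
proof -
  obtain c A where "finite A" "\<And>\<alpha>. 0 \<le> c \<alpha>" "f m = (\<Sum>\<alpha>\<in>A. c \<alpha> * fundamental_qsym \<alpha> m)"
    using cone_expansion[OF assms] by (metis order_refl)
  then show ?thesis by (auto intro!: sum_nonneg simp: fundamental_qsym_apply)
qed

text \<open>
  The partitions that occur in the Schur expansion of \<open>f\<close> are squeezed between a lower bound, read off
  from monomials, and an upper bound, read off from fundamental functions.
\<close>
lemma schur_summand_proportional:
  assumes part: "partition \<mu>" and f: "f \<in> F_positive_cone" and g: "g \<in> F_positive_cone"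
    and sum: "schur \<mu> = f + g"
  shows "\<exists>a. f = scale a (schur \<mu>)"
proof -
  let ?n = "sum_list \<mu>"
  let ?P = "partitions_of ?n"
  \<comment> \<open>Nonnegativity excludes cancellation against \<open>g\<close>.\<close>
  have below: "schur \<mu> m \<noteq> 0" if "f m \<noteq> 0" for m
    using that cone_nonneg[OF f, of m] cone_nonneg[OF g, of m] by (simp add: sum)
  have "f \<in> Sym" using f by (simp add: F_positive_cone_def)
  moreover have "total_degree m = ?n" if "f m \<noteq> 0" for m
    using schur_nonzero_degree[OF part below[OF that]] .
  ultimately obtain a where a: "\<And>m. f m = (\<Sum>\<nu>\<in>?P. a \<nu> * schur \<nu> m)"
    using symmetric_schur_combination by metis
  obtain c A where c: "finite A" "\<forall>\<alpha>\<in>A. composition \<alpha>" "\<And>\<alpha>. 0 \<le> c \<alpha>"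
    "\<And>\<alpha>. \<alpha> \<notin> A \<Longrightarrow> c \<alpha> = 0" "\<And>B m. finite B \<Longrightarrow> A \<subseteq> B \<Longrightarrow> f m = (\<Sum>\<alpha>\<in>B. c \<alpha> * fundamental_qsym \<alpha> m)"
    using cone_expansion[OF f] by metis
  obtain d D where d: "finite D" "\<forall>\<alpha>\<in>D. composition \<alpha>" "\<And>\<alpha>. 0 \<le> d \<alpha>"
    "\<And>\<alpha>. \<alpha> \<notin> D \<Longrightarrow> d \<alpha> = 0" "\<And>B m. finite B \<Longrightarrow> D \<subseteq> B \<Longrightarrow> g m = (\<Sum>\<alpha>\<in>B. d \<alpha> * fundamental_qsym \<alpha> m)"
    using cone_expansion[OF g] by metis
  define B where "B = A \<union> D \<union> {\<alpha>. composition \<alpha> \<and> sum_list \<alpha> = ?n}"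
  have B: "finite B" "\<forall>\<alpha>\<in>B. composition \<alpha>" "A \<subseteq> B" "D \<subseteq> B" "{\<alpha>. composition \<alpha> \<and> sum_list \<alpha> = ?n} \<subseteq> B"
    using c(1,2) d(1,2) finite_compositions by (auto simp: B_def)
  have expand: "schur \<nu> m = (\<Sum>\<alpha>\<in>B. of_nat (schur_coeff \<nu> \<alpha>) * fundamental_qsym \<alpha> m)" if "\<nu> \<in> ?P" for \<nu> m
    using that B(1,5) by (intro schur_expansion) auto
  have coeff: "c \<alpha> = (\<Sum>\<nu>\<in>?P. a \<nu> * of_nat (schur_coeff \<nu> \<alpha>))" if "\<alpha> \<in> B" for \<alpha>
  proof (rule fundamental_coefficients_unique[OF B(1,2) _ that])
    fix m
    have "(\<Sum>\<alpha>\<in>B. c \<alpha> * fundamental_qsym \<alpha> m) = (\<Sum>\<nu>\<in>?P. \<Sum>\<alpha>\<in>B. a \<nu> * of_nat (schur_coeff \<nu> \<alpha>) * fundamental_qsym \<alpha> m)"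
      unfolding c(5)[OF B(1,3), symmetric] a
      by (intro sum.cong refl) (subst expand, simp_all add: sum_distrib_left mult.assoc)
    also have "\<dots> = (\<Sum>\<alpha>\<in>B. (\<Sum>\<nu>\<in>?P. a \<nu> * of_nat (schur_coeff \<nu> \<alpha>)) * fundamental_qsym \<alpha> m)"
      by (subst sum.swap) (simp add: sum_distrib_right)
    finally show "(\<Sum>\<alpha>\<in>B. c \<alpha> * fundamental_qsym \<alpha> m) = \<dots>" .
  qed
  have support: "schur_coeff \<mu> \<alpha> \<noteq> 0" if "\<alpha> \<in> B" "c \<alpha> \<noteq> 0" for \<alpha>
  proof -
    have "c \<alpha> + d \<alpha> = of_nat (schur_coeff \<mu> \<alpha>)"
    proof (rule fundamental_coefficients_unique[OF B(1,2) _ that(1)])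
      fix m show "(\<Sum>\<alpha>\<in>B. (c \<alpha> + d \<alpha>) * fundamental_qsym \<alpha> m) = (\<Sum>\<alpha>\<in>B. of_nat (schur_coeff \<mu> \<alpha>) * fundamental_qsym \<alpha> m)"
        using expand[of \<mu> m] c(5)[OF B(1,3), of m] d(5)[OF B(1,4), of m] sum part
        by (simp add: distrib_right sum.distrib)
    qed
    then show ?thesis using c(3)[of \<alpha>] d(3)[of \<alpha>] that(2) by auto
  qed
  define S where "S = {\<nu>\<in>?P. a \<nu> \<noteq> 0}"
  have finS: "finite S"
    by (rule finite_subset[OF _ finite_partitions_of[of ?n]]) (auto simp: S_def)
  \<comment> \<open>Every other Schur function that contains this monomial has a smaller \<open>row_index_sum\<close>.\<close>
  have min: "row_index_sum \<mu> \<le> row_index_sum \<nu> \<and> (row_index_sum \<mu> = row_index_sum \<nu> \<longrightarrow> \<mu> = \<nu>)"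
    if \<nu>: "\<nu> \<in> S" "\<forall>\<kappa>\<in>S. row_index_sum \<nu> \<le> row_index_sum \<kappa>" for \<nu>
  proof -
    have zero: "a \<kappa> * schur \<kappa> (dominant_monomial \<nu>) = 0" if "\<kappa> \<in> ?P" "\<kappa> \<noteq> \<nu>" for \<kappa>
      using that \<nu> schur_dominant_nonzero[of \<kappa> \<nu>] by (fastforce simp: S_def)
    have "f (dominant_monomial \<nu>) = (\<Sum>\<kappa>\<in>{\<nu>}. a \<kappa> * schur \<kappa> (dominant_monomial \<nu>))"
      unfolding a using \<nu>(1) zero by (intro sum.mono_neutral_right finite_partitions_of) (auto simp: S_def)
    then have "f (dominant_monomial \<nu>) \<noteq> 0"
      using \<nu>(1) schur_dominant_self[of \<nu>] by (simp add: S_def)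
    then show ?thesis
      using schur_dominant_nonzero[OF part _ below] \<nu>(1) by (simp add: S_def)
  qed
  \<comment> \<open>Every other Schur function that contains \<open>F\<^sub>\<alpha>\<close> has a larger \<open>row_index_sum\<close>.\<close>
  have max: "row_index_sum \<nu> \<le> row_index_sum \<mu>" if \<nu>: "\<nu> \<in> S" "\<forall>\<kappa>\<in>S. row_index_sum \<kappa> \<le> row_index_sum \<nu>" for \<nu>
  proof -
    have "partition \<nu>" using \<nu>(1) by (simp add: S_def)
    then obtain \<alpha> where \<alpha>: "schur_coeff \<nu> \<alpha> \<noteq> 0"
      "\<And>\<kappa>. partition \<kappa> \<Longrightarrow> schur_coeff \<kappa> \<alpha> \<noteq> 0 \<Longrightarrow> row_index_sum \<nu> \<le> row_index_sum \<kappa> \<and> (row_index_sum \<nu> = row_index_sum \<kappa> \<longrightarrow> \<nu> = \<kappa>)"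
      using ex_extremal_descents by blast
    have "\<alpha> \<in> B" using schur_coeff_nonzero[OF \<alpha>(1)] \<nu>(1) B(5) by (auto simp: S_def)
    have zero: "a \<kappa> * of_nat (schur_coeff \<kappa> \<alpha>) = 0" if "\<kappa> \<in> ?P" "\<kappa> \<noteq> \<nu>" for \<kappa>
      using that \<nu> \<alpha>(2)[of \<kappa>] by (fastforce simp: S_def)
    have "c \<alpha> = (\<Sum>\<kappa>\<in>{\<nu>}. a \<kappa> * of_nat (schur_coeff \<kappa> \<alpha>))"
      unfolding coeff[OF \<open>\<alpha> \<in> B\<close>] using \<nu>(1) zero
      by (intro sum.mono_neutral_right finite_partitions_of) (auto simp: S_def)
    then have "c \<alpha> \<noteq> 0" using \<nu>(1) \<alpha>(1) by (simp add: S_def)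
    then show ?thesis using support[OF \<open>\<alpha> \<in> B\<close>] \<alpha>(2) part by blast
  qed
  have "\<nu> = \<mu>" if "\<nu> \<in> S" for \<nu>
  proof -
    have "S \<noteq> {}" using that by blast
    obtain lo where lo: "lo \<in> S" "\<forall>\<kappa>\<in>S. row_index_sum lo \<le> row_index_sum \<kappa>"
      using arg_min_if_finite[OF finS \<open>S \<noteq> {}\<close>, of row_index_sum] by (meson not_le)
    obtain hi where hi: "hi \<in> S" "\<forall>\<kappa>\<in>S. row_index_sum \<kappa> \<le> row_index_sum hi"
      using obtains_MAX[OF finS \<open>S \<noteq> {}\<close>, of row_index_sum] finS by (metis Max_ge finite_imageI imageI)
    have "row_index_sum \<mu> \<le> row_index_sum lo" "row_index_sum hi \<le> row_index_sum \<mu>" using min[OF lo] max[OF hi] by auto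
    then have const: "row_index_sum \<kappa> = row_index_sum \<mu>" if "\<kappa> \<in> S" for \<kappa>
      using lo(2) hi(2) that by (meson le_antisym le_trans)
    then show ?thesis using min[of \<nu>] that by simp
  qed
  then have "a \<nu> = 0" if "\<nu> \<in> ?P" "\<nu> \<noteq> \<mu>" for \<nu> using that by (auto simp: S_def)
  then have "f m = (\<Sum>\<nu>\<in>{\<mu>}. a \<nu> * schur \<nu> m)" for m
    unfolding a using part by (intro sum.mono_neutral_right finite_partitions_of) auto
  then have "f = scale (a \<mu>) (schur \<mu>)" by (simp add: scale_def fun_eq_iff)
  then show ?thesis ..
qed

theorem theorem6p3:
  fixes \<mu> :: "nat list"
  assumes "partition \<mu>"
  shows "schur \<mu> \<in> F_positive_cone \<and>
    (\<forall>F\<^sub>1\<in>F_positive_cone. \<forall>F\<^sub>2\<in>F_positive_cone. schur \<mu> = F\<^sub>1 + F\<^sub>2 \<longrightarrow>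
      (\<exists>a. F\<^sub>1 = scale a (schur \<mu>)) \<and> (\<exists>b. F\<^sub>2 = scale b (schur \<mu>)))"
proof (intro conjI ballI impI)
  show "schur \<mu> \<in> F_positive_cone" using assms by (rule schur_in_cone)
next
  fix f g assume fg: "f \<in> F_positive_cone" "g \<in> F_positive_cone" "schur \<mu> = f + g"
  show "\<exists>a. f = scale a (schur \<mu>)" using assms fg by (rule schur_summand_proportional)
  have "schur \<mu> = g + f" using fg(3) by (simp add: add.commute)
  with assms fg(2,1) show "\<exists>b. g = scale b (schur \<mu>)" by (rule schur_summand_proportional)
qed

end
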